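(* Let $G$ be a finite group of odd order. If $\mathrm{anz}(G) < 1$, then $G$ is supersolvable.
   Context: For a finite group $G$, $\mathrm{Irr}(G)$ denotes the set of complex irreducible characters of $G$. $\mathrm{nz}(G)$ denotes the number of zeros in the character table of $G$, i.e. the number of pairs $(\chi, C)$ with $\chi\in\mathrm{Irr}(G)$ and $C$ a conjugacy class of $G$ such that $\chi$ is $0$ on $C$. The average number of zeros of characters of $G$ is $\mathrm{anz}(G) := \mathrm{nz}(G)/|\mathrm{Irr}(G)|$. *)

theory Defs
  imports
    Complex_Main
    "HOL-Algebra.Group_Action"
    "HOL-Algebra.Elementary_Groups"
    "Jordan_Normal_Form.VS_Connect"
begin

definition GL :: "nat \<Rightarrow> complex mat monoid" where
  "GL n = units_of (ring_mat TYPE(complex) n ())"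

definition representation ::
    "('a, 'b) monoid_scheme \<Rightarrow> nat \<Rightarrow> ('a \<Rightarrow> complex mat) \<Rightarrow> bool" where
  "representation G n \<rho> \<longleftrightarrow> \<rho> \<in> hom G (GL n)"

definition irreducible_representation ::
    "('a, 'b) monoid_scheme \<Rightarrow> nat \<Rightarrow> ('a \<Rightarrow> complex mat) \<Rightarrow> bool" where
  "irreducible_representation G n \<rho> \<longleftrightarrow>
     representation G n \<rho> \<and> n > 0 \<and>
     (\<forall>W. VectorSpace.subspace class_ring W (module_vec TYPE(complex) n) \<and>
          (\<forall>g\<in>carrier G. \<forall>w\<in>W. \<rho> g *\<^sub>v w \<in> W)
        \<longrightarrow> W = {0\<^sub>v n} \<or> W = carrier_vec n)"

definition mat_trace :: "complex mat \<Rightarrow> complex" where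
  "mat_trace A = sum_list (diag_mat A)"

text \<open>Characters are restricted to the carrier, so that characters which agree on the
  group are equal as HOL functions and \<open>Irr G\<close> has no spurious duplicates.\<close>

definition character ::
    "('a, 'b) monoid_scheme \<Rightarrow> ('a \<Rightarrow> complex mat) \<Rightarrow> 'a \<Rightarrow> complex" where
  "character G \<rho> = (\<lambda>g\<in>carrier G. mat_trace (\<rho> g))"

definition Irr :: "('a, 'b) monoid_scheme \<Rightarrow> ('a \<Rightarrow> complex) set" where
  "Irr G = {character G \<rho> | n \<rho>. irreducible_representation G n \<rho>}"

definition conjugacy_classes :: "('a, 'b) monoid_scheme \<Rightarrow> 'a set set" where
  "conjugacy_classes G =
     orbits G (carrier G) (\<lambda>g. \<lambda>h\<in>carrier G. g \<otimes>\<^bsub>G\<^esub> h \<otimes>\<^bsub>G\<^esub> inv\<^bsub>G\<^esub> g)"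

definition nz :: "('a, 'b) monoid_scheme \<Rightarrow> nat" where
  "nz G = card {(\<chi>, C). \<chi> \<in> Irr G \<and> C \<in> conjugacy_classes G \<and> (\<forall>g\<in>C. \<chi> g = 0)}"

definition anz :: "('a, 'b) monoid_scheme \<Rightarrow> real" where
  "anz G = real (nz G) / real (card (Irr G))"

text \<open>Every term of the series is normal in the whole group, not only in the next term.\<close>

definition supersolvable :: "('a, 'b) monoid_scheme \<Rightarrow> bool" where
  "supersolvable G \<longleftrightarrow>
     (\<exists>(N :: nat \<Rightarrow> 'a set) k.
        N 0 = {\<one>\<^bsub>G\<^esub>} \<and> N k = carrier G \<and>
        (\<forall>i\<le>k. N i \<lhd> G) \<and>
        (\<forall>i<k. N i \<subseteq> N (Suc i) \<and>
               cyclic_group ((G\<lparr>carrier := N (Suc i)\<rparr>) Mod (N i))))"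

end

(* Multiplying a character by a linear character preserves its zeros, and a character that is fixed by
   a linear character vanishes outside the kernel of the latter. By Burnside, a nonlinear character has
   a zero, and in odd order a zero class comes with its distinct inverse class. So anz G < 1 forces the
   stabiliser of each nonlinear character among the linear ones to have at least three elements and
   the character to vanish off the derived subgroup G'. Comparing with the number of classes, a
   nonabelian G has exactly three linear and two nonlinear characters; then G' consists of 1 and a pair
   of inverse classes, whence |G'| is 3 or 7 while |G : G'| = 3. *)
theory Submission
  imports
    Defs
    "HOL-Algebra.Multiplicative_Group"
    "Jordan_Normal_Form.Schur_Decomposition"
    "Jordan_Normal_Form.Spectral_Radius"
begin

section \<open>Representations and invariant subspaces\<close>

text \<open>The hypothesis is used as an excess count. Linear characters have no zeros, so
  \<open>anz G < 1\<close> says that the zeros exceeding one per nonlinear character are fewer than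
  the linear characters. All members of an orbit under multiplication by linear characters carry the
  same excess, and the orbit is at least as long as the number of linear characters divided by the
  order of the stabiliser; hence a nonlinear character has no more zero classes than its stabiliser
  has elements. Two zeros would still allow a stabiliser of order two, but that order is impossible
  because no nontrivial linear character of a group of odd order takes only the values 1 and -1. The
  final orders come from arithmetic: if the two inverse classes in G' have size q, then q divides
  |G| = 3(1 + 2q), so q divides 3. Both factors of the series 1 < G' < G then have prime order. The
  character theory behind this is built on matrices: bounds on families of characters are instances
  of Bessel's inequality, and Burnside's theorem rests on integrality of sums over primitive roots
  of unity.\<close>

lemma mat_trace_sum: "mat_trace A = (\<Sum>i<dim_row A. A $$ (i,i))"
  by (simp add: mat_trace_def diag_mat_def sum_list_sum_nth atLeast0LessThan)

lemma mat_trace_comm: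
  assumes "A \<in> carrier_mat n m" "B \<in> carrier_mat m n"
  shows "mat_trace (A * B) = mat_trace (B * A)"
proof -
  have "mat_trace (A * B) = (\<Sum>i<n. \<Sum>j<m. A $$ (i,j) * B $$ (j,i))"
    using assms by (auto simp: mat_trace_sum scalar_prod_def atLeast0LessThan)
  also have "\<dots> = (\<Sum>j<m. \<Sum>i<n. B $$ (j,i) * A $$ (i,j))"
    by (subst sum.swap) (simp add: mult.commute)
  also have "\<dots> = mat_trace (B * A)"
    using assms by (auto simp: mat_trace_sum scalar_prod_def atLeast0LessThan)
  finally show ?thesis .
qed

lemma mat_trace_one: "mat_trace (1\<^sub>m n) = of_nat n"
  by (simp add: mat_trace_sum)

lemma mat_trace_smult: "A \<in> carrier_mat n n \<Longrightarrow> mat_trace (c \<cdot>\<^sub>m A) = c * mat_trace A"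
  by (auto simp: mat_trace_sum sum_distrib_left)

lemma mat_trace_conj:
  assumes "A \<in> carrier_mat n n" "P \<in> carrier_mat n n" "Q \<in> carrier_mat n n" "P * Q = 1\<^sub>m n"
  shows "mat_trace (Q * A * P) = mat_trace A"
proof -
  have "mat_trace (Q * A * P) = mat_trace (P * (Q * A))"
    using assms by (intro mat_trace_comm) auto
  also have "P * (Q * A) = A"
    using assms by (metis assoc_mult_mat left_mult_one_mat)
  finally show ?thesis .
qed

lemma Units_ring_mat:
  "Units (ring_mat TYPE(complex) n ()) =
     {A \<in> carrier_mat n n. \<exists>B\<in>carrier_mat n n. A * B = 1\<^sub>m n \<and> B * A = 1\<^sub>m n}"
  by (auto simp: Units_def ring_mat_simps)

context group
begin

lemma representationD:
  assumes "representation G n \<rho>"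
  shows rep_carrier: "\<And>g. g \<in> carrier G \<Longrightarrow> \<rho> g \<in> carrier_mat n n"
    and rep_mult: "\<And>g h. g \<in> carrier G \<Longrightarrow> h \<in> carrier G \<Longrightarrow> \<rho> (g \<otimes> h) = \<rho> g * \<rho> h"
    and rep_one: "\<rho> \<one> = 1\<^sub>m n"
proof -
  have h: "\<rho> \<in> hom G (GL n)" using assms by (simp add: representation_def)
  show c: "\<rho> g \<in> carrier_mat n n" if "g \<in> carrier G" for g
    using hom_in_carrier[OF h that] by (auto simp: GL_def units_of_def Units_ring_mat)
  show m: "\<rho> (g \<otimes> k) = \<rho> g * \<rho> k" if "g \<in> carrier G" "k \<in> carrier G" for g k
    using hom_mult[OF h that] by (auto simp: GL_def units_of_def ring_mat_simps)
  have "\<rho> \<one> \<in> carrier (GL n)" using hom_in_carrier[OF h] by simp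
  then obtain B where B: "B \<in> carrier_mat n n" "\<rho> \<one> * B = 1\<^sub>m n" "B * \<rho> \<one> = 1\<^sub>m n"
    by (auto simp: GL_def units_of_def Units_ring_mat)
  \<comment> \<open>An invertible idempotent matrix is the identity.\<close>
  have "\<rho> \<one> = B * (\<rho> \<one> * \<rho> \<one>)"
    using B c[of \<one>] by (metis assoc_mult_mat left_mult_one_mat one_closed)
  also have "\<dots> = 1\<^sub>m n" using m[of \<one> \<one>] B by simp
  finally show "\<rho> \<one> = 1\<^sub>m n" .
qed

lemma representationI:
  assumes "\<And>g. g \<in> carrier G \<Longrightarrow> \<rho> g \<in> carrier_mat n n"
    and "\<And>g h. g \<in> carrier G \<Longrightarrow> h \<in> carrier G \<Longrightarrow> \<rho> (g \<otimes> h) = \<rho> g * \<rho> h"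
    and "\<rho> \<one> = 1\<^sub>m n"
  shows "representation G n \<rho>"
  unfolding representation_def hom_def GL_def units_of_def Units_ring_mat
proof (intro CollectI conjI ballI Pi_I, simp_all add: ring_mat_simps assms)
  fix g assume g: "g \<in> carrier G"
  show "\<exists>B\<in>carrier_mat n n. \<rho> g * B = 1\<^sub>m n \<and> B * \<rho> g = 1\<^sub>m n"
    using g assms(1)[of "inv g"] assms(2)[of g "inv g"] assms(2)[of "inv g" g] assms(3)
    by (intro bexI[of _ "\<rho> (inv g)"]) auto
qed

end

lemma subspace_vec_iff:
  "VectorSpace.subspace class_ring W (module_vec TYPE(complex) n) \<longleftrightarrow>
     W \<subseteq> carrier_vec n \<and> 0\<^sub>v n \<in> W \<and> (\<forall>v\<in>W. \<forall>w\<in>W. v + w \<in> W) \<and>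
     (\<forall>c. \<forall>v\<in>W. c \<cdot>\<^sub>v v \<in> W)"
  using vec_vs[where ?'a = complex, of n] vec_module[where ?'a = complex, of n]
  by (auto simp: VectorSpace.subspace_def submodule_def module_vec_simps class_ring_simps)

lemma span_imp_mat_of_cols:
  fixes ws :: "complex vec list"
  assumes "set ws \<subseteq> carrier_vec n" "v \<in> LinearCombinations.module.span class_ring (module_vec TYPE(complex) n) (set ws)"
  obtains u where "u \<in> carrier_vec (length ws)" "v = mat_of_cols n ws *\<^sub>v u"
proof -
  interpret vec_space "TYPE(complex)" n .
  obtain c where "v = lincomb_list c ws"
    using assms span_list_as_span[OF assms(1)] by (auto simp: span_list_def)
  also have "\<dots> = mat_of_cols n ws *\<^sub>v vec (length ws) c"
    using assms(1) by (intro lincomb_list_as_mat_mult) auto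
  finally show ?thesis by (intro that[of "vec (length ws) c"]) auto
qed

text \<open>A maximal independent subset of \<open>W\<close> supplies the first \<open>a\<close>
  columns of \<open>P\<close>, and the exchange lemma completes it to a generating set. In these
  coordinates an invariant subspace shows as a zero block.\<close>

lemma adapted_basis:
  fixes W :: "complex vec set"
  assumes "VectorSpace.subspace class_ring W (module_vec TYPE(complex) n)"
  obtains P Q a where "P \<in> carrier_mat n n" "Q \<in> carrier_mat n n" "P * Q = 1\<^sub>m n" "Q * P = 1\<^sub>m n"
    "a \<le> n" "W = {P *\<^sub>v v | v. v \<in> carrier_vec n \<and> (\<forall>i. a \<le> i \<and> i < n \<longrightarrow> v $ i = 0)}"
proof -
  interpret vec_space "TYPE(complex)" n .
  have W: "W \<subseteq> carrier_vec n" "0\<^sub>v n \<in> W" "\<And>v w. v \<in> W \<Longrightarrow> w \<in> W \<Longrightarrow> v + w \<in> W"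
      "\<And>c v. v \<in> W \<Longrightarrow> c \<cdot>\<^sub>v v \<in> W"
    using assms by (auto simp: subspace_vec_iff)
  \<comment> \<open>An independent subset of \<open>W\<close> of greatest cardinality is chosen, the
    dimension being the bound; maximality makes it span \<open>W\<close>.\<close>
  define good where "good = (\<lambda>A. A \<subseteq> W \<and> lin_indpt A)"
  have "good {}" by (auto simp: good_def lin_dep_def)
  have bound: "finite A \<and> card A \<le> n" if "good A" for A
    using that li_le_dim[of A] W dim_is_n by (auto simp: good_def)
  obtain A where A: "good A" and max: "\<And>B. good B \<Longrightarrow> card B \<le> card A"
    using ex_has_greatest_nat[of good "{}" card "Suc n", OF \<open>good {}\<close>] bound
    by (auto simp: less_Suc_eq_le)
  have finA: "finite A" and cardA: "card A \<le> n" and AW: "A \<subseteq> W" and liA: "lin_indpt A"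
    using bound A by (auto simp: good_def)
  have AC: "A \<subseteq> carrier_vec n" using AW W by auto
  have WA: "W \<subseteq> span A"
  proof
    fix w assume w: "w \<in> W"
    show "w \<in> span A"
    proof (rule ccontr)
      assume n: "w \<notin> span A"
      hence "w \<notin> A" using in_own_span[OF AC] by auto
      hence "lin_indpt (A \<union> {w})"
        using lin_dep_iff_in_span[of A w] n w W AC liA by auto
      hence "good (A \<union> {w})" using w AW by (auto simp: good_def)
      from max[OF this] show False using \<open>w \<notin> A\<close> finA by simp
    qed
  qed
  have Au: "A \<subseteq> span (set (unit_vecs n))" by (simp add: AC span_unit_vecs_is_carrier)
  have uc: "set (unit_vecs n) \<subseteq> carrier_vec n" by (rule unit_vecs_carrier)
  have cu: "card (set (unit_vecs n :: complex vec list)) = n" by (simp add: distinct_card unit_vecs_distinct)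
  from replacement[OF finA finite_set uc liA Au]
  obtain C where "finite C \<and> C \<subseteq> carrier_vec n \<and> C \<subseteq> span (set (unit_vecs n)) \<and> C \<inter> A = {} \<and>
      int (card C) \<le> int (card (set (unit_vecs n :: complex vec list))) - int (card A) \<and>
      span (A \<union> C) = span (set (unit_vecs n))" ..
  hence C: "finite C" "C \<subseteq> carrier_vec n" "int (card C) \<le> int n - int (card A)"
    "span (A \<union> C) = span (set (unit_vecs n))"
    unfolding cu by simp_all
  have cc: "card C + card A \<le> n" using C(3) by linarith
  obtain la where la: "set la = A" "length la = card A"
    using finite_distinct_list[OF finA] distinct_card by metis
  obtain lc where lc: "set lc = C" "length lc = card C"
    using finite_distinct_list[OF C(1)] distinct_card by metis
  \<comment> \<open>The exchange lemma bounds the number of added vectors only from above, so zero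
    vectors pad the list to length \<open>n\<close>; this makes \<open>P\<close> square.\<close>
  define ws where "ws = la @ lc @ replicate (n - (card C + card A)) (0\<^sub>v n)"
  have len: "length ws = n" using cc la lc by (simp add: ws_def)
  have wsC: "set ws \<subseteq> carrier_vec n" using AC C la lc by (auto simp: ws_def)
  define P where "P = mat_of_cols n ws"
  have P: "P \<in> carrier_mat n n" using len by (auto simp: P_def)
  have "\<exists>u\<in>carrier_vec n. v = P *\<^sub>v u" if v: "v \<in> carrier_vec n" for v
  proof -
    have "v \<in> span (A \<union> C)" using C(4) v span_unit_vecs_is_carrier by simp
    hence "v \<in> span (set ws)" using span_is_monotone[of "A \<union> C" "set ws"] la lc by (auto simp: ws_def)
    from span_imp_mat_of_cols[OF wsC this] len show ?thesis by (auto simp: P_def)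
  qed
  then obtain f where f: "\<And>v. v \<in> carrier_vec n \<Longrightarrow> f v \<in> carrier_vec n \<and> v = P *\<^sub>v f v" by metis
  \<comment> \<open>Preimages of the unit vectors form a right inverse, which for a square matrix is
    two-sided.\<close>
  define Q where "Q = mat_of_cols n (map (\<lambda>i. f (unit_vec n i)) [0..<n])"
  have Q: "Q \<in> carrier_mat n n" by (auto simp: Q_def)
  have PQ: "P * Q = 1\<^sub>m n"
  proof (rule mat_col_eqI)
    fix i assume "i < dim_col (1\<^sub>m n :: complex mat)"
    hence i: "i < n" by simp
    have "col Q i = f (unit_vec n i)" using i f[of "unit_vec n i"] by (simp add: Q_def)
    thus "col (P * Q) i = col (1\<^sub>m n) i"
      using i f[of "unit_vec n i"] col_mult2[OF P Q i] by simp
  qed (use P Q in auto)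
  have QP: "Q * P = 1\<^sub>m n" using mat_mult_left_right_inverse[OF P Q PQ] .
  define Z where "Z = {v \<in> carrier_vec n. \<forall>i. card A \<le> i \<and> i < n \<longrightarrow> v $ i = (0::complex)}"
  have ws_nth: "ws ! i = la ! i" if "i < card A" for i using that la by (simp add: ws_def nth_append)
  have "W \<subseteq> (\<lambda>v. P *\<^sub>v v) ` Z"
  proof
    fix w assume "w \<in> W"
    hence "w \<in> span (set la)" using WA la by auto
    then obtain u where u: "u \<in> carrier_vec (card A)" "w = mat_of_cols n la *\<^sub>v u"
      using span_imp_mat_of_cols[of la n w] AC la by metis
    define v where "v = vec n (\<lambda>i. if i < card A then u $ i else 0)"
    have "v \<in> Z" by (auto simp: Z_def v_def)
    moreover have "w = P *\<^sub>v v"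
    proof (rule eq_vecI)
      fix r assume "r < dim_vec (P *\<^sub>v v)"
      hence r: "r < n" using P by simp
      have "(P *\<^sub>v v) $ r = (\<Sum>i<n. ws ! i $ r * v $ i)"
        using r len by (simp add: P_def v_def scalar_prod_def atLeast0LessThan mat_of_cols_def)
      also have "\<dots> = (\<Sum>i<card A. ws ! i $ r * v $ i)"
        using cardA by (intro sum.mono_neutral_right) (auto simp: v_def)
      also have "\<dots> = (\<Sum>i<card A. la ! i $ r * u $ i)"
        using cardA by (intro sum.cong) (auto simp: v_def ws_nth)
      also have "\<dots> = w $ r"
        using r u la by (simp add: u(2) scalar_prod_def atLeast0LessThan mat_of_cols_def)
      finally show "w $ r = (P *\<^sub>v v) $ r" ..
    qed (use u P in auto)
    ultimately show "w \<in> (\<lambda>v. P *\<^sub>v v) ` Z" by blast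
  qed
  moreover have "(\<lambda>v. P *\<^sub>v v) ` Z \<subseteq> W"
  proof safe
    fix v assume v: "v \<in> Z"
    have part: "vec n (\<lambda>r. \<Sum>i<k. ws ! i $ r * v $ i) \<in> W" if "k \<le> card A" for k
      using that
    proof (induction k)
      case 0 thus ?case using W(2) by (simp add: zero_vec_def)
    next
      case (Suc k)
      have k: "ws ! k \<in> W" using Suc.prems la AW ws_nth[of k] by (metis Suc_le_eq nth_mem subsetD)
      have "vec n (\<lambda>r. \<Sum>i<Suc k. ws ! i $ r * v $ i) =
          vec n (\<lambda>r. \<Sum>i<k. ws ! i $ r * v $ i) + v $ k \<cdot>\<^sub>v ws ! k"
        using k W(1) by (intro eq_vecI) (auto simp: mult.commute)
      thus ?case using Suc W(3,4) k by simp
    qed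
    have "P *\<^sub>v v = vec n (\<lambda>r. \<Sum>i<card A. ws ! i $ r * v $ i)"
    proof (rule eq_vecI)
      fix r assume "r < dim_vec (vec n (\<lambda>r. \<Sum>i<card A. ws ! i $ r * v $ i))"
      hence r: "r < n" by simp
      have "(P *\<^sub>v v) $ r = (\<Sum>i<n. ws ! i $ r * v $ i)"
        using r len v by (auto simp: P_def Z_def scalar_prod_def atLeast0LessThan mat_of_cols_def intro!: sum.cong)
      also have "\<dots> = (\<Sum>i<card A. ws ! i $ r * v $ i)"
        using cardA v by (intro sum.mono_neutral_right) (auto simp: Z_def)
      finally show "(P *\<^sub>v v) $ r = vec n (\<lambda>r. \<Sum>i<card A. ws ! i $ r * v $ i) $ r" using r by simp
    qed (use P in auto)
    thus "P *\<^sub>v v \<in> W" using part[of "card A"] by simp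
  qed
  ultimately have "W = (\<lambda>v. P *\<^sub>v v) ` Z" by blast
  hence "W = {P *\<^sub>v v | v. v \<in> carrier_vec n \<and> (\<forall>i. card A \<le> i \<and> i < n \<longrightarrow> v $ i = 0)}"
    by (auto simp: Z_def)
  with that P Q PQ QP cardA show ?thesis by blast
qed

lemma mat_eq_by_vec:
  fixes A B :: "'a::comm_ring_1 mat"
  assumes "A \<in> carrier_mat m n" "B \<in> carrier_mat m n"
    and "\<And>v. v \<in> carrier_vec n \<Longrightarrow> A *\<^sub>v v = B *\<^sub>v v"
  shows "A = B"
proof (rule mat_col_eqI)
  fix i assume "i < dim_col B"
  hence i: "i < n" using assms by simp
  have "A * 1\<^sub>m n = A" "B * 1\<^sub>m n = B" using assms by auto
  hence "col A i = A *\<^sub>v unit_vec n i" "col B i = B *\<^sub>v unit_vec n i"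
    using i assms(1,2) by (metis col_mult2 col_one one_carrier_mat)+
  thus "col A i = col B i" using assms(3) by simp
qed (use assms in auto)

section \<open>Schur orthogonality and completeness\<close>

locale fin_group = group +
  assumes fin: "finite (carrier G)"
begin

lemma irreducible_representationD:
  assumes "irreducible_representation G n \<rho>"
  shows irr_rep: "representation G n \<rho>" and irr_pos: "n > 0"
    and irr_subspace: "\<And>W. \<lbrakk>W \<subseteq> carrier_vec n; 0\<^sub>v n \<in> W; \<And>v w. v \<in> W \<Longrightarrow> w \<in> W \<Longrightarrow> v + w \<in> W;
       \<And>c v. v \<in> W \<Longrightarrow> c \<cdot>\<^sub>v v \<in> W; \<And>g v. g \<in> carrier G \<Longrightarrow> v \<in> W \<Longrightarrow> \<rho> g *\<^sub>v v \<in> W\<rbrakk>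
       \<Longrightarrow> W = {0\<^sub>v n} \<or> W = carrier_vec n"
  using assms unfolding irreducible_representation_def subspace_vec_iff by metis+

text \<open>An invariant subspace puts every \<open>\<rho> g\<close> in block triangular form; both
  diagonal blocks are multiplicative and their traces add up. Only traces matter later, so the block
  above the diagonal is left as it is.\<close>

lemma reducible_split:
  assumes \<rho>: "representation G n \<rho>" and n: "n > 0" and red: "\<not> irreducible_representation G n \<rho>"
  obtains a b \<rho>1 \<rho>2 where "a < n" "b < n" "representation G a \<rho>1" "representation G b \<rho>2"
    "\<And>g. g \<in> carrier G \<Longrightarrow> mat_trace (\<rho> g) = mat_trace (\<rho>1 g) + mat_trace (\<rho>2 g)"
proof -
  obtain W where W: "VectorSpace.subspace class_ring W (module_vec TYPE(complex) n)"
    and inv: "\<And>g w. g \<in> carrier G \<Longrightarrow> w \<in> W \<Longrightarrow> \<rho> g *\<^sub>v w \<in> W"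
    and W0: "W \<noteq> {0\<^sub>v n}" and W1: "W \<noteq> carrier_vec n"
    using assms unfolding irreducible_representation_def by blast
  obtain P Q a where P: "P \<in> carrier_mat n n" and Q: "Q \<in> carrier_mat n n"
    and PQ: "P * Q = 1\<^sub>m n" and QP: "Q * P = 1\<^sub>m n" and an: "a \<le> n"
    and WP: "W = {P *\<^sub>v v | v. v \<in> carrier_vec n \<and> (\<forall>i. a \<le> i \<and> i < n \<longrightarrow> v $ i = 0)}"
    by (rule adapted_basis[OF W])
  have "a \<noteq> 0"
  proof
    assume "a = 0"
    hence "v = 0\<^sub>v n" if "v \<in> carrier_vec n \<and> (\<forall>i. a \<le> i \<and> i < n \<longrightarrow> v $ i = 0)" for v :: "complex vec"
      using that by (intro eq_vecI) auto
    moreover have "P *\<^sub>v 0\<^sub>v n = 0\<^sub>v n" using P by (intro eq_vecI) auto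
    ultimately have "W \<subseteq> {0\<^sub>v n}" by (auto simp: WP)
    thus False using W0 W by (auto simp: subspace_vec_iff)
  qed
  have "a \<noteq> n"
  proof
    assume "a = n"
    have "v \<in> W" if v: "v \<in> carrier_vec n" for v
    proof -
      have "v = P *\<^sub>v (Q *\<^sub>v v)" using v P Q PQ by (simp flip: assoc_mult_mat_vec)
      thus ?thesis using v Q \<open>a = n\<close> by (auto simp: WP)
    qed
    thus False using W1 W by (auto simp: subspace_vec_iff)
  qed
  note rc = rep_carrier[OF \<rho>]
  define M where "M = (\<lambda>g. Q * \<rho> g * P)"
  have M: "M g \<in> carrier_mat n n" if "g \<in> carrier G" for g using rc[OF that] P Q by (auto simp: M_def)
  have Mm: "M (g \<otimes> h) = M g * M h" if g: "g \<in> carrier G" and h: "h \<in> carrier G" for g h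
  proof -
    have "M g * M h = Q * \<rho> g * (P * Q) * \<rho> h * P"
      using rc[OF g] rc[OF h] P Q unfolding M_def by (simp add: assoc_mult_mat[of _ n n _ n _ n])
    thus ?thesis
      using rc[OF g] rc[OF h] P Q PQ rep_mult[OF \<rho> g h]
      by (simp add: M_def assoc_mult_mat[of _ n n _ n _ n])
  qed
  have M1: "M \<one> = 1\<^sub>m n" using rep_one[OF \<rho>] P Q QP by (simp add: M_def)
  \<comment> \<open>The first \<open>a\<close> basis vectors span the invariant \<open>W\<close>, so
    the lower left block vanishes.\<close>
  have M0: "M g $$ (i, j) = 0" if g: "g \<in> carrier G" and i: "a \<le> i" "i < n" and j: "j < a" for g i j
  proof -
    have "P *\<^sub>v unit_vec n j \<in> W" using j an by (auto simp: WP intro!: exI[of _ "unit_vec n j"])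
    from inv[OF g this] obtain v where v: "v \<in> carrier_vec n" "\<forall>i. a \<le> i \<and> i < n \<longrightarrow> v $ i = 0"
      "\<rho> g *\<^sub>v (P *\<^sub>v unit_vec n j) = P *\<^sub>v v" by (auto simp: WP)
    have "M g *\<^sub>v unit_vec n j = Q *\<^sub>v (\<rho> g *\<^sub>v (P *\<^sub>v unit_vec n j))"
      using rc[OF g] P Q by (simp add: M_def assoc_mult_mat_vec[of _ n n _ n])
    also have "\<dots> = v" using v P Q QP by (simp flip: assoc_mult_mat_vec)
    finally have "M g *\<^sub>v unit_vec n j = v" .
    moreover have "(M g *\<^sub>v unit_vec n j) $ i = M g $$ (i, j)"
      using M[OF g] i j an by (auto simp: scalar_prod_right_unit)
    ultimately show ?thesis using v i by simp
  qed
  define \<rho>1 where "\<rho>1 = (\<lambda>g. mat a a (\<lambda>(i,j). M g $$ (i,j)))"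
  define \<rho>2 where "\<rho>2 = (\<lambda>g. mat (n-a) (n-a) (\<lambda>(i,j). M g $$ (i+a,j+a)))"
  have split: "(\<Sum>k<n. f k) = (\<Sum>k<a. f k) + (\<Sum>k<n-a. f (k+a))" for f :: "nat \<Rightarrow> complex"
  proof -
    have "(\<Sum>k<n. f k) = (\<Sum>k<a. f k) + (\<Sum>k=a..<n. f k)"
      using an by (metis atLeast0LessThan sum.atLeastLessThan_concat zero_le)
    also have "(\<Sum>k=a..<n. f k) = (\<Sum>k<n-a. f (k+a))"
      using sum.shift_bounds_nat_ivl[of f 0 a "n-a"] an by (simp add: atLeast0LessThan)
    finally show ?thesis .
  qed
  have Mmul: "M (g \<otimes> h) $$ (i,j) = (\<Sum>k<n. M g $$ (i,k) * M h $$ (k,j))"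
    if "g \<in> carrier G" "h \<in> carrier G" "i < n" "j < n" for g h i j
    using that M[OF that(1)] M[OF that(2)] by (simp add: Mm scalar_prod_def atLeast0LessThan)
  have r1: "representation G a \<rho>1"
  proof (rule representationI)
    show "\<rho>1 \<one> = 1\<^sub>m a" using an by (auto simp: \<rho>1_def M1)
    show "\<rho>1 (g \<otimes> h) = \<rho>1 g * \<rho>1 h" if "g \<in> carrier G" "h \<in> carrier G" for g h
      using that an by (intro eq_matI)
        (auto simp: \<rho>1_def Mmul split scalar_prod_def atLeast0LessThan M0 intro!: sum.neutral)
  qed (simp add: \<rho>1_def)
  have r2: "representation G (n - a) \<rho>2"
  proof (rule representationI)
    show "\<rho>2 \<one> = 1\<^sub>m (n - a)" using an by (auto simp: \<rho>2_def M1)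
    show "\<rho>2 (g \<otimes> h) = \<rho>2 g * \<rho>2 h" if "g \<in> carrier G" "h \<in> carrier G" for g h
      using that an by (intro eq_matI)
        (auto simp: \<rho>2_def Mmul split scalar_prod_def atLeast0LessThan M0 intro!: sum.neutral)
  qed (simp add: \<rho>2_def)
  have tr: "mat_trace (\<rho> g) = mat_trace (\<rho>1 g) + mat_trace (\<rho>2 g)" if g: "g \<in> carrier G" for g
  proof -
    have "mat_trace (\<rho> g) = mat_trace (M g)"
      using mat_trace_conj[OF rc[OF g] P Q PQ] by (simp add: M_def)
    thus ?thesis using M[OF g] by (simp add: mat_trace_sum split \<rho>1_def \<rho>2_def)
  qed
  show ?thesis
    by (rule that[OF _ _ r1 r2 tr]) (use \<open>a \<noteq> 0\<close> \<open>a \<noteq> n\<close> an in auto)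
qed

lemma Irr_I: "irreducible_representation G n \<rho> \<Longrightarrow> character G \<rho> \<in> Irr G"
  by (auto simp: Irr_def)

text \<open>Induction on the dimension along \<open>reducible_split\<close>. It carries a linear
  condition on irreducible characters over to the regular representation.\<close>

lemma sum_trace_eq_0:
  assumes F: "\<And>\<chi>. \<chi> \<in> Irr G \<Longrightarrow> (\<Sum>g\<in>carrier G. F g * \<chi> g) = 0"
    and "representation G n \<rho>"
  shows "(\<Sum>g\<in>carrier G. F g * mat_trace (\<rho> g)) = 0"
  using assms(2)
proof (induction n arbitrary: \<rho> rule: less_induct)
  case (less n)
  consider "n = 0" | "irreducible_representation G n \<rho>" | "n > 0" "\<not> irreducible_representation G n \<rho>"
    by auto
  thus ?case
  proof cases
    case 1
    hence "mat_trace (\<rho> g) = 0" if "g \<in> carrier G" for g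
      using rep_carrier[OF less.prems that] by (simp add: mat_trace_sum)
    thus ?thesis by simp
  next
    case 2
    from F[OF Irr_I[OF this]] show ?thesis by (simp add: character_def)
  next
    case 3
    from reducible_split[OF less.prems 3] obtain a b \<rho>1 \<rho>2 where
      ab: "a < n" "b < n" "representation G a \<rho>1" "representation G b \<rho>2"
      "\<And>g. g \<in> carrier G \<Longrightarrow> mat_trace (\<rho> g) = mat_trace (\<rho>1 g) + mat_trace (\<rho>2 g)" by metis
    have "(\<Sum>g\<in>carrier G. F g * mat_trace (\<rho> g)) =
        (\<Sum>g\<in>carrier G. F g * mat_trace (\<rho>1 g)) + (\<Sum>g\<in>carrier G. F g * mat_trace (\<rho>2 g))"
      by (simp add: ab(5) distrib_left sum.distrib)
    thus ?thesis using less.IH[OF ab(1,3)] less.IH[OF ab(2,4)] by simp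
  qed
qed

text \<open>Kernel and image of an intertwiner are invariant, so a nonzero one is bijective. The
  dimensions \<open>m\<close> and \<open>n\<close> may differ a priori, hence the explicit two-sided
  inverse.\<close>

lemma schur:
  assumes \<rho>: "irreducible_representation G n \<rho>" and \<sigma>: "irreducible_representation G m \<sigma>"
    and X: "X \<in> carrier_mat m n" and nz: "X \<noteq> 0\<^sub>m m n"
    and comm: "\<And>g. g \<in> carrier G \<Longrightarrow> X * \<rho> g = \<sigma> g * X"
  obtains Y where "Y \<in> carrier_mat n m" "X * Y = 1\<^sub>m m" "Y * X = 1\<^sub>m n"
proof -
  note rc = rep_carrier[OF irr_rep[OF \<rho>]] and sc = rep_carrier[OF irr_rep[OF \<sigma>]]
  have cv: "X *\<^sub>v (\<rho> g *\<^sub>v v) = \<sigma> g *\<^sub>v (X *\<^sub>v v)" if "g \<in> carrier G" "v \<in> carrier_vec n" for g v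
    using that X rc[OF that(1)] sc[OF that(1)] comm[OF that(1)]
    by (metis assoc_mult_mat_vec)
  have X0: False if "\<And>v. v \<in> carrier_vec n \<Longrightarrow> X *\<^sub>v v = 0\<^sub>v m"
  proof -
    have "X = 0\<^sub>m m n" using that by (intro mat_eq_by_vec[OF X]) auto
    thus False using nz by simp
  qed
  define K where "K = {v \<in> carrier_vec n. X *\<^sub>v v = 0\<^sub>v m}"
  have "K = {0\<^sub>v n} \<or> K = carrier_vec n"
  proof (rule irr_subspace[OF \<rho>])
    fix g v assume "g \<in> carrier G" "v \<in> K"
    thus "\<rho> g *\<^sub>v v \<in> K" using rc[of g] sc[of g] by (auto simp: K_def cv)
  qed (use X in \<open>auto simp: K_def mult_add_distrib_mat_vec mult_mat_vec\<close>)
  hence K: "K = {0\<^sub>v n}" using X0 by (auto simp: K_def)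
  define I where "I = (\<lambda>v. X *\<^sub>v v) ` carrier_vec n"
  have "I = {0\<^sub>v m} \<or> I = carrier_vec m"
  proof (rule irr_subspace[OF \<sigma>])
    have "X *\<^sub>v 0\<^sub>v n = 0\<^sub>v m" using X by (intro eq_vecI) auto
    thus "0\<^sub>v m \<in> I" unfolding I_def by (metis imageI zero_carrier_vec)
    fix v w assume "v \<in> I" "w \<in> I"
    thus "v + w \<in> I" using X by (auto simp: I_def simp flip: mult_add_distrib_mat_vec intro!: imageI)
  next
    fix c v assume "v \<in> I"
    thus "c \<cdot>\<^sub>v v \<in> I" using X by (auto simp: I_def simp flip: mult_mat_vec intro!: imageI)
  next
    fix g v assume "g \<in> carrier G" "v \<in> I"
    thus "\<sigma> g *\<^sub>v v \<in> I" using X rc[of g] by (auto simp: I_def simp flip: cv intro!: imageI)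
  qed (use X in \<open>auto simp: I_def\<close>)
  hence "I = carrier_vec m" using X0 by (auto simp: I_def)
  hence "\<forall>w\<in>carrier_vec m. \<exists>v\<in>carrier_vec n. X *\<^sub>v v = w" unfolding I_def by (metis imageE)
  then obtain f where f: "\<And>w. w \<in> carrier_vec m \<Longrightarrow> f w \<in> carrier_vec n \<and> X *\<^sub>v f w = w" by metis
  define Y where "Y = mat_of_cols n (map (\<lambda>i. f (unit_vec m i)) [0..<m])"
  have Y: "Y \<in> carrier_mat n m" by (auto simp: Y_def)
  have XY: "X * Y = 1\<^sub>m m"
  proof (rule mat_col_eqI)
    fix i assume "i < dim_col (1\<^sub>m m :: complex mat)"
    hence i: "i < m" by simp
    have "col Y i = f (unit_vec m i)" using i f[of "unit_vec m i"] by (simp add: Y_def)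
    thus "col (X * Y) i = col (1\<^sub>m m) i" using i f[of "unit_vec m i"] col_mult2[OF X Y i] by simp
  qed (use X Y in auto)
  \<comment> \<open>The right inverse is also a left inverse because
    \<open>Y *\<^sub>v (X *\<^sub>v v) - v\<close> lies in the trivial kernel
    \<open>K\<close>.\<close>
  have "Y * X = 1\<^sub>m n"
  proof (rule mat_eq_by_vec)
    fix v :: "complex vec" assume v: "v \<in> carrier_vec n"
    define u where "u = Y *\<^sub>v (X *\<^sub>v v) - v"
    have u: "u \<in> carrier_vec n" using X Y v by (auto simp: u_def)
    have "X *\<^sub>v u = X *\<^sub>v (Y *\<^sub>v (X *\<^sub>v v)) - X *\<^sub>v v"
      using X Y v by (simp add: u_def mult_minus_distrib_mat_vec)
    also have "X *\<^sub>v (Y *\<^sub>v (X *\<^sub>v v)) = X *\<^sub>v v"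
      using X Y v XY by (simp flip: assoc_mult_mat_vec[of X m n Y m])
    finally have "u \<in> K" using u X v by (auto simp: K_def)
    hence "u = 0\<^sub>v n" using K by auto
    have "Y *\<^sub>v (X *\<^sub>v v) = v"
    proof (rule eq_vecI)
      fix i assume "i < dim_vec v"
      thus "(Y *\<^sub>v (X *\<^sub>v v)) $ i = v $ i"
        using arg_cong[OF \<open>u = 0\<^sub>v n\<close>, of "\<lambda>u. u $ i"] v Y by (simp add: u_def del: index_mult_mat_vec)
    qed (use Y v in auto)
    thus "Y * X *\<^sub>v v = 1\<^sub>m n *\<^sub>v v" using X Y v by simp
  qed (use X Y in auto)
  with that Y XY show ?thesis by blast
qed

text \<open>Over the complex numbers \<open>X\<close> has an eigenvalue \<open>c\<close>; then
  \<open>X\<close> minus the scalar \<open>c\<close> still intertwines but is not injective, so it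
  is zero by \<open>schur\<close>.\<close>

lemma schur_scalar:
  assumes \<rho>: "irreducible_representation G n \<rho>" and X: "X \<in> carrier_mat n n"
    and comm: "\<And>g. g \<in> carrier G \<Longrightarrow> X * \<rho> g = \<rho> g * X"
  obtains c where "X = c \<cdot>\<^sub>m 1\<^sub>m n"
proof -
  note rc = rep_carrier[OF irr_rep[OF \<rho>]]
  obtain c v where v: "v \<in> carrier_vec n" "v \<noteq> 0\<^sub>v n" "X *\<^sub>v v = c \<cdot>\<^sub>v v"
    using spectrum_non_empty[OF X] irr_pos[OF \<rho>] X
    by (auto simp: spectrum_def eigenvalue_def eigenvector_def)
  define Z where "Z = X - c \<cdot>\<^sub>m 1\<^sub>m n"
  have Z: "Z \<in> carrier_mat n n" by (auto simp: Z_def)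
  have "Z = 0\<^sub>m n n"
  proof (rule ccontr)
    assume "Z \<noteq> 0\<^sub>m n n"
    moreover have "Z * \<rho> g = \<rho> g * Z" if g: "g \<in> carrier G" for g
    proof -
      have "Z * \<rho> g = X * \<rho> g - c \<cdot>\<^sub>m \<rho> g"
        using X rc[OF g] by (simp add: Z_def minus_mult_distrib_mat[of _ n n _ _ n] mult_smult_assoc_mat[of _ n n _ n])
      moreover have "\<rho> g * Z = \<rho> g * X - c \<cdot>\<^sub>m \<rho> g"
        using X rc[OF g] by (simp add: Z_def mult_minus_distrib_mat[of _ n n _ n] mult_smult_distrib[of _ n n _ n])
      ultimately show ?thesis using comm[OF g] by simp
    qed
    ultimately obtain Y where Y: "Y \<in> carrier_mat n n" "Y * Z = 1\<^sub>m n"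
      using schur[OF \<rho> \<rho> Z] by metis
    have "(c \<cdot>\<^sub>m 1\<^sub>m n) *\<^sub>v v = c \<cdot>\<^sub>v v"
      using v by (intro eq_vecI) auto
    hence "Z *\<^sub>v v = 0\<^sub>v n"
      using v X by (simp add: Z_def minus_mult_distrib_mat_vec[of _ n n])
    hence "Y *\<^sub>v (Z *\<^sub>v v) = 0\<^sub>v n" using Y by (intro eq_vecI) auto
    hence "v = 0\<^sub>v n" using Y Z v by (simp flip: assoc_mult_mat_vec[of Y n n Z n])
    thus False using v by simp
  qed
  have "X = c \<cdot>\<^sub>m 1\<^sub>m n"
  proof (rule eq_matI)
    fix i j assume ij: "i < dim_row (c \<cdot>\<^sub>m 1\<^sub>m n)" "j < dim_col (c \<cdot>\<^sub>m 1\<^sub>m n)"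
    show "X $$ (i,j) = (c \<cdot>\<^sub>m 1\<^sub>m n) $$ (i,j)"
      using arg_cong[OF \<open>Z = 0\<^sub>m n n\<close>, of "\<lambda>A. A $$ (i,j)"] ij X by (simp add: Z_def)
  qed (use X in auto)
  thus ?thesis by (rule that)
qed

text \<open>The matrix \<open>\<Sum>g. \<sigma> g * E * \<rho> (inv g)\<close> for the \<open>(i,j)\<close>-th matrix unit \<open>E\<close>.\<close>

definition average :: "('a \<Rightarrow> complex mat) \<Rightarrow> ('a \<Rightarrow> complex mat) \<Rightarrow> nat \<Rightarrow> nat \<Rightarrow> nat \<Rightarrow> nat \<Rightarrow> complex mat" where
  "average \<sigma> \<rho> m n i j = mat m n (\<lambda>(k,l). \<Sum>g\<in>carrier G. \<sigma> g $$ (k,i) * \<rho> (inv g) $$ (j,l))"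

lemma sum_mult_left: "h \<in> carrier G \<Longrightarrow> (\<Sum>g\<in>carrier G. f (h \<otimes> g)) = (\<Sum>g\<in>carrier G. f g)"
  by (rule sum.reindex_bij_witness[of _ "\<lambda>g. inv h \<otimes> g" "\<lambda>g. h \<otimes> g"])
     (simp_all add: m_assoc[symmetric])

lemma sum_mult_right: "h \<in> carrier G \<Longrightarrow> (\<Sum>g\<in>carrier G. f (g \<otimes> h)) = (\<Sum>g\<in>carrier G. f g)"
  by (rule sum.reindex_bij_witness[of _ "\<lambda>g. g \<otimes> inv h" "\<lambda>g. g \<otimes> h"])
     (simp_all add: m_assoc)

lemma sum_inv: "(\<Sum>g\<in>carrier G. f (inv g)) = (\<Sum>g\<in>carrier G. f g)"
  by (rule sum.reindex_bij_witness[of _ "\<lambda>g. inv g" "\<lambda>g. inv g"]) auto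

lemma rep_mult_index:
  assumes "representation G n \<rho>" "g \<in> carrier G" "h \<in> carrier G" "i < n" "j < n"
  shows "\<rho> (g \<otimes> h) $$ (i,j) = (\<Sum>k<n. \<rho> g $$ (i,k) * \<rho> h $$ (k,j))"
  using rep_carrier[OF assms(1)] assms
  by (simp add: rep_mult[OF assms(1)] scalar_prod_def atLeast0LessThan carrier_matD[OF rep_carrier[OF assms(1)]])

text \<open>Translation invariance of the sum over the group: replacing \<open>g\<close> by
  \<open>h \<otimes> g\<close> trades \<open>\<sigma> h\<close> on the left for
  \<open>\<rho> h\<close> on the right.\<close>

lemma average_intertwines:
  assumes \<rho>: "representation G n \<rho>" and \<sigma>: "representation G m \<sigma>"
    and i: "i < m" and j: "j < n" and h: "h \<in> carrier G"
  shows "average \<sigma> \<rho> m n i j * \<rho> h = \<sigma> h * average \<sigma> \<rho> m n i j"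
proof (rule eq_matI)
  note rc = rep_carrier[OF \<rho> h] and sc = rep_carrier[OF \<sigma> h]
  fix k l assume "k < dim_row (\<sigma> h * average \<sigma> \<rho> m n i j)" "l < dim_col (\<sigma> h * average \<sigma> \<rho> m n i j)"
  hence k: "k < m" and l: "l < n" using sc by (auto simp: average_def)
  have "(\<sigma> h * average \<sigma> \<rho> m n i j) $$ (k,l) =
      (\<Sum>p<m. \<sigma> h $$ (k,p) * (\<Sum>g\<in>carrier G. \<sigma> g $$ (p,i) * \<rho> (inv g) $$ (j,l)))"
    using k l sc by (simp add: average_def scalar_prod_def atLeast0LessThan)
  also have "\<dots> = (\<Sum>g\<in>carrier G. (\<Sum>p<m. \<sigma> h $$ (k,p) * \<sigma> g $$ (p,i)) * \<rho> (inv g) $$ (j,l))"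
    unfolding sum_distrib_left sum_distrib_right by (subst sum.swap) (simp add: mult.assoc)
  also have "\<dots> = (\<Sum>g\<in>carrier G. \<sigma> (h \<otimes> g) $$ (k,i) * \<rho> (inv (h \<otimes> g) \<otimes> h) $$ (j,l))"
    using h k i by (intro sum.cong) (auto simp: rep_mult_index[OF \<sigma>] inv_mult_group m_assoc)
  also have "\<dots> = (\<Sum>g\<in>carrier G. \<sigma> g $$ (k,i) * \<rho> (inv g \<otimes> h) $$ (j,l))"
    by (rule sum_mult_left[OF h, of "\<lambda>g. \<sigma> g $$ (k,i) * \<rho> (inv g \<otimes> h) $$ (j,l)"])
  also have "\<dots> = (\<Sum>g\<in>carrier G. \<sigma> g $$ (k,i) * (\<Sum>p<n. \<rho> (inv g) $$ (j,p) * \<rho> h $$ (p,l)))"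
    using h j l by (intro sum.cong) (auto simp: rep_mult_index[OF \<rho>])
  also have "\<dots> = (\<Sum>p<n. (\<Sum>g\<in>carrier G. \<sigma> g $$ (k,i) * \<rho> (inv g) $$ (j,p)) * \<rho> h $$ (p,l))"
    unfolding sum_distrib_left sum_distrib_right by (subst sum.swap) (simp add: mult.assoc)
  also have "\<dots> = (average \<sigma> \<rho> m n i j * \<rho> h) $$ (k,l)"
    using k l rc by (simp add: average_def scalar_prod_def atLeast0LessThan)
  finally show "(average \<sigma> \<rho> m n i j * \<rho> h) $$ (k,l) = (\<sigma> h * average \<sigma> \<rho> m n i j) $$ (k,l)" ..
qed (use rep_carrier[OF \<rho> h] rep_carrier[OF \<sigma> h] in \<open>auto simp: average_def\<close>)

text \<open>Reduces the orthogonality relations to single entries of averaged matrix units, where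
  Schur's lemma applies.\<close>

lemma sum_trace_average:
  assumes \<rho>: "representation G n \<rho>" and \<sigma>: "representation G m \<sigma>"
  shows "(\<Sum>g\<in>carrier G. mat_trace (\<sigma> g) * mat_trace (\<rho> (inv g))) =
    (\<Sum>k<m. \<Sum>l<n. average \<sigma> \<rho> m n k l $$ (k,l))"
proof -
  have "(\<Sum>g\<in>carrier G. mat_trace (\<sigma> g) * mat_trace (\<rho> (inv g))) =
    (\<Sum>g\<in>carrier G. \<Sum>k<m. \<Sum>l<n. \<sigma> g $$ (k,k) * \<rho> (inv g) $$ (l,l))"
    using rep_carrier[OF \<rho>] rep_carrier[OF \<sigma>]
    by (intro sum.cong refl) (simp add: mat_trace_sum sum_product carrier_matD[OF rep_carrier[OF \<rho>]]
       carrier_matD[OF rep_carrier[OF \<sigma>]])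
  also have "\<dots> = (\<Sum>k<m. \<Sum>l<n. \<Sum>g\<in>carrier G. \<sigma> g $$ (k,k) * \<rho> (inv g) $$ (l,l))"
    by (simp only: sum.swap[of _ _ "carrier G"])
  also have "\<dots> = (\<Sum>k<m. \<Sum>l<n. average \<sigma> \<rho> m n k l $$ (k,l))"
    by (simp add: average_def)
  finally show ?thesis .
qed

text \<open>A nonzero average would be an invertible intertwiner, and similar representations have
  equal traces.\<close>

lemma orthogonality_distinct:
  assumes \<rho>: "irreducible_representation G n \<rho>" and \<sigma>: "irreducible_representation G m \<sigma>"
    and ne: "character G \<rho> \<noteq> character G \<sigma>"
  shows "(\<Sum>g\<in>carrier G. mat_trace (\<sigma> g) * mat_trace (\<rho> (inv g))) = 0"
proof -
  note rr = irr_rep[OF \<rho>] and sr = irr_rep[OF \<sigma>]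
  have "average \<sigma> \<rho> m n i j = 0\<^sub>m m n" if i: "i < m" and j: "j < n" for i j
  proof (rule ccontr)
    define X where "X = average \<sigma> \<rho> m n i j"
    assume nz: "average \<sigma> \<rho> m n i j \<noteq> 0\<^sub>m m n"
    have X: "X \<in> carrier_mat m n" by (simp add: X_def average_def)
    obtain Y where Y: "Y \<in> carrier_mat n m" "X * Y = 1\<^sub>m m" "Y * X = 1\<^sub>m n"
      using schur[OF \<rho> \<sigma> X] nz average_intertwines[OF rr sr i j] unfolding X_def by metis
    have "mat_trace (\<sigma> g) = mat_trace (\<rho> g)" if g: "g \<in> carrier G" for g
    proof -
      note rc = rep_carrier[OF rr g] and sc = rep_carrier[OF sr g]
      have "mat_trace (\<rho> g) = mat_trace (\<rho> g * (Y * X))" using Y rc by simp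
      also have "\<dots> = mat_trace (\<rho> g * Y * X)" using Y rc X by (simp add: assoc_mult_mat[of _ n n _ m _ n])
      also have "\<dots> = mat_trace (X * (\<rho> g * Y))" using Y rc X by (intro mat_trace_comm) auto
      also have "X * (\<rho> g * Y) = (X * \<rho> g) * Y" using Y rc X by (simp add: assoc_mult_mat[of _ m n _ n _ m])
      also have "X * \<rho> g = \<sigma> g * X" using average_intertwines[OF rr sr i j g] by (simp add: X_def)
      also have "\<sigma> g * X * Y = \<sigma> g" using Y sc X by (simp add: assoc_mult_mat[of _ m m _ n _ m])
      finally show ?thesis ..
    qed
    hence "character G \<rho> = character G \<sigma>" by (auto simp: character_def)
    thus False using ne by simp
  qed
  thus ?thesis by (simp add: sum_trace_average[OF rr sr])
qed



text \<open>By Schur each average is a scalar matrix; its trace is \<open>card (carrier G)\<close>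
  times the trace of the matrix unit, so only the diagonal units contribute.\<close>

lemma orthogonality_same:
  assumes \<rho>: "irreducible_representation G n \<rho>"
  shows "(\<Sum>g\<in>carrier G. mat_trace (\<rho> g) * mat_trace (\<rho> (inv g))) = of_nat (card (carrier G))"
proof -
  note rr = irr_rep[OF \<rho>]
  have n: "n > 0" using irr_pos[OF \<rho>] .
  have diag: "average \<rho> \<rho> n n i j $$ (i,j) = (if i = j then of_nat (card (carrier G)) / of_nat n else 0)"
    if i: "i < n" and j: "j < n" for i j
  proof -
    have X: "average \<rho> \<rho> n n i j \<in> carrier_mat n n" by (simp add: average_def)
    obtain c where c: "average \<rho> \<rho> n n i j = c \<cdot>\<^sub>m 1\<^sub>m n"
      using schur_scalar[OF \<rho> X average_intertwines[OF rr rr i j]] .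
    have "of_nat n * c = mat_trace (average \<rho> \<rho> n n i j)"
      by (simp add: c mat_trace_smult[of _ n] mat_trace_one)
    also have "\<dots> = (\<Sum>k<n. \<Sum>g\<in>carrier G. \<rho> g $$ (k,i) * \<rho> (inv g) $$ (j,k))"
      by (simp add: mat_trace_sum average_def)
    also have "\<dots> = (\<Sum>g\<in>carrier G. \<Sum>k<n. \<rho> (inv g) $$ (j,k) * \<rho> g $$ (k,i))"
      by (subst sum.swap) (simp add: mult.commute)
    also have "\<dots> = (\<Sum>g\<in>carrier G. \<rho> (inv g \<otimes> g) $$ (j,i))"
      using i j by (intro sum.cong) (simp_all add: rep_mult_index[OF rr] del: l_inv Units_l_inv)
    also have "\<dots> = (if i = j then of_nat (card (carrier G)) else 0)"
      using i j by (simp add: rep_one[OF rr])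
    finally have "c = (if i = j then of_nat (card (carrier G)) / of_nat n else 0)"
      using n by (auto simp: field_simps split: if_splits)
    thus ?thesis using i j by (simp add: c)
  qed
  show ?thesis using n by (simp add: sum_trace_average[OF rr rr] diag)
qed

text \<open>The matrix sum commutes with the representation because \<open>f\<close> is constant on
  classes, so it is scalar, and its trace is the sum that vanishes by \<open>z\<close>.\<close>

lemma class_sum_zero:
  assumes \<rho>: "irreducible_representation G n \<rho>"
    and classfn: "\<And>g h. g \<in> carrier G \<Longrightarrow> h \<in> carrier G \<Longrightarrow> f (h \<otimes> g \<otimes> inv h) = f g"
    and z: "(\<Sum>g\<in>carrier G. f g * mat_trace (\<rho> g)) = 0" and ij: "i < n" "j < n"
  shows "(\<Sum>g\<in>carrier G. f g * \<rho> g $$ (i,j)) = 0"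
proof -
  note rr = irr_rep[OF \<rho>]
  define X where "X = mat n n (\<lambda>(i,j). \<Sum>g\<in>carrier G. f g * \<rho> g $$ (i,j))"
  have X: "X \<in> carrier_mat n n" by (simp add: X_def)
  have comm: "X * \<rho> h = \<rho> h * X" if h: "h \<in> carrier G" for h
  proof (rule eq_matI)
    note rc = rep_carrier[OF rr h]
    fix k l assume "k < dim_row (\<rho> h * X)" "l < dim_col (\<rho> h * X)"
    hence k: "k < n" and l: "l < n" using rc by (auto simp: X_def)
    have "(\<rho> h * X) $$ (k,l) = (\<Sum>p<n. \<rho> h $$ (k,p) * (\<Sum>g\<in>carrier G. f g * \<rho> g $$ (p,l)))"
      using k l rc by (simp add: X_def scalar_prod_def atLeast0LessThan)
    also have "\<dots> = (\<Sum>g\<in>carrier G. f g * (\<Sum>p<n. \<rho> h $$ (k,p) * \<rho> g $$ (p,l)))"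
      unfolding sum_distrib_left by (subst sum.swap) (simp add: mult_ac)
    also have "\<dots> = (\<Sum>g\<in>carrier G. f g * \<rho> (h \<otimes> g) $$ (k,l))"
      using h k l by (intro sum.cong) (auto simp: rep_mult_index[OF rr])
    also have "\<dots> = (\<Sum>g\<in>carrier G. f (inv h \<otimes> (g \<otimes> h)) * \<rho> (g \<otimes> h) $$ (k,l))"
      using sum_mult_left[OF h, of "\<lambda>g. f (inv h \<otimes> g) * \<rho> g $$ (k,l)"]
        sum_mult_right[OF h, of "\<lambda>g. f (inv h \<otimes> g) * \<rho> g $$ (k,l)"] h
      by (simp add: m_assoc[symmetric] cong: sum.cong)
    also have "\<dots> = (\<Sum>g\<in>carrier G. f g * \<rho> (g \<otimes> h) $$ (k,l))"
      using h classfn[of _ "inv h"] by (intro sum.cong) (auto simp: m_assoc)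
    also have "\<dots> = (\<Sum>g\<in>carrier G. f g * (\<Sum>p<n. \<rho> g $$ (k,p) * \<rho> h $$ (p,l)))"
      using h k l by (intro sum.cong) (auto simp: rep_mult_index[OF rr])
    also have "\<dots> = (\<Sum>p<n. (\<Sum>g\<in>carrier G. f g * \<rho> g $$ (k,p)) * \<rho> h $$ (p,l))"
      unfolding sum_distrib_left sum_distrib_right by (subst sum.swap) (simp add: mult_ac)
    also have "\<dots> = (X * \<rho> h) $$ (k,l)"
      using k l rc by (simp add: X_def scalar_prod_def atLeast0LessThan)
    finally show "(X * \<rho> h) $$ (k,l) = (\<rho> h * X) $$ (k,l)" ..
  qed (use rep_carrier[OF rr h] in \<open>auto simp: X_def\<close>)
  obtain c where c: "X = c \<cdot>\<^sub>m 1\<^sub>m n" using schur_scalar[OF \<rho> X comm] .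
  have "of_nat n * c = mat_trace X" by (simp add: c mat_trace_smult[of _ n] mat_trace_one)
  also have "\<dots> = (\<Sum>g\<in>carrier G. \<Sum>i<n. f g * \<rho> g $$ (i,i))"
    by (subst sum.swap) (simp add: mat_trace_sum X_def)
  also have "\<dots> = (\<Sum>g\<in>carrier G. f g * mat_trace (\<rho> g))"
    by (intro sum.cong) (auto simp: mat_trace_sum sum_distrib_left carrier_matD[OF rep_carrier[OF rr]])
  finally have "c = 0" using z irr_pos[OF \<rho>] by simp
  hence "X $$ (i,j) = 0" using ij by (simp add: c)
  thus ?thesis using ij by (simp add: X_def)
qed

text \<open>Translating \<open>f\<close> by \<open>x\<close> preserves the vanishing in \<open>class_sum_zero\<close>, and pairing the
  translate with the regular character picks out \<open>f x\<close>.\<close>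

lemma class_function_eq_0:
  assumes classfn: "\<And>g h. g \<in> carrier G \<Longrightarrow> h \<in> carrier G \<Longrightarrow> f (h \<otimes> g \<otimes> inv h) = f g"
    and z: "\<And>\<chi>. \<chi> \<in> Irr G \<Longrightarrow> (\<Sum>g\<in>carrier G. f g * \<chi> g) = 0" and x: "x \<in> carrier G"
  shows "f x = 0"
proof -
  define N where "N = card (carrier G)"
  obtain e where e: "bij_betw e {..<N} (carrier G)"
    using ex_bij_betw_nat_finite[OF fin] by (auto simp: N_def atLeast0LessThan)
  have ec: "e i \<in> carrier G" if "i < N" for i using e that by (auto simp: bij_betw_def)
  have ei: "e i = e j \<longleftrightarrow> i = j" if "i < N" "j < N" for i j
    using e that by (auto simp: bij_betw_def inj_on_def)
  \<comment> \<open>The left regular representation, with the group enumerated by \<open>e\<close>: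
    permutation matrices whose trace counts fixed points.\<close>
  define reg where "reg = (\<lambda>g. mat N N (\<lambda>(i,j). if e i = g \<otimes> e j then 1 else (0::complex)))"
  have reg: "representation G N reg"
  proof (rule representationI)
    show "reg \<one> = 1\<^sub>m N" by (auto simp: reg_def ec ei)
    fix g h assume g: "g \<in> carrier G" and h: "h \<in> carrier G"
    show "reg (g \<otimes> h) = reg g * reg h"
    proof (rule eq_matI)
      fix i j assume "i < dim_row (reg g * reg h)" "j < dim_col (reg g * reg h)"
      hence i: "i < N" and j: "j < N" by (auto simp: reg_def)
      obtain k where k: "k < N" "e k = h \<otimes> e j"
        using e h ec[OF j] by (metis bij_betw_imp_surj_on imageE lessThan_iff m_closed)
      have "(reg g * reg h) $$ (i,j) = (\<Sum>p<N. (if e i = g \<otimes> e p then 1 else 0) * (if e p = h \<otimes> e j then 1 else 0))"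
        using i j by (simp add: reg_def scalar_prod_def atLeast0LessThan)
      also have "\<dots> = (\<Sum>p<N. if p = k then (if e i = g \<otimes> e p then 1 else 0) else 0)"
        using k by (intro sum.cong) (auto simp flip: k(2) simp: ei)
      also have "\<dots> = reg (g \<otimes> h) $$ (i,j)"
        using k i j g h ec[OF j] by (simp add: reg_def m_assoc)
      finally show "reg (g \<otimes> h) $$ (i,j) = (reg g * reg h) $$ (i,j)" ..
    qed (auto simp: reg_def)
  qed (simp add: reg_def)
  have tr: "mat_trace (reg g) = (if g = \<one> then of_nat N else 0)" if g: "g \<in> carrier G" for g
  proof -
    have "e i = g \<otimes> e i \<longleftrightarrow> g = \<one>" if "i < N" for i
      using g ec[OF that] by (metis l_one r_cancel_one)
    thus ?thesis by (simp add: mat_trace_sum reg_def)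
  qed
  have "(\<Sum>g\<in>carrier G. f (g \<otimes> x) * mat_trace (reg g)) = 0"
  proof (rule sum_trace_eq_0[OF _ reg])
    fix \<chi> assume "\<chi> \<in> Irr G"
    then obtain n \<rho> where \<rho>: "irreducible_representation G n \<rho>" and \<chi>: "\<chi> = character G \<rho>"
      by (auto simp: Irr_def)
    note rr = irr_rep[OF \<rho>]
    have z': "(\<Sum>g\<in>carrier G. f g * mat_trace (\<rho> g)) = 0"
      using z[OF \<open>\<chi> \<in> Irr G\<close>] by (simp add: \<chi> character_def)
    have "(\<Sum>g\<in>carrier G. f (g \<otimes> x) * \<chi> g) = (\<Sum>g\<in>carrier G. f g * \<chi> (g \<otimes> inv x))"
      using sum_mult_right[OF x, of "\<lambda>g. f g * \<chi> (g \<otimes> inv x)"] x by (simp add: m_assoc cong: sum.cong)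
    \<comment> \<open>Expanding \<open>\<rho> (g \<otimes> inv x)\<close> into entries separates
      \<open>g\<close> from \<open>x\<close>, so that \<open>class_sum_zero\<close> applies
      entrywise.\<close>
    also have "\<dots> = (\<Sum>g\<in>carrier G. \<Sum>i<n. \<Sum>k<n. f g * \<rho> g $$ (i,k) * \<rho> (inv x) $$ (k,i))"
      using x by (intro sum.cong) (auto simp: \<chi> character_def mat_trace_sum carrier_matD[OF rep_carrier[OF rr]]
        rep_mult_index[OF rr] sum_distrib_left mult.assoc)
    also have "\<dots> = (\<Sum>i<n. \<Sum>k<n. (\<Sum>g\<in>carrier G. f g * \<rho> g $$ (i,k)) * \<rho> (inv x) $$ (k,i))"
      by (simp only: sum.swap[of _ _ "carrier G"] sum_distrib_right)
    also have "\<dots> = 0" using class_sum_zero[OF \<rho> classfn z'] by simp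
    finally show "(\<Sum>g\<in>carrier G. f (g \<otimes> x) * \<chi> g) = 0" .
  qed
  also have "(\<Sum>g\<in>carrier G. f (g \<otimes> x) * mat_trace (reg g)) =
      (\<Sum>g\<in>carrier G. if g = \<one> then f (g \<otimes> x) * of_nat N else 0)"
    by (intro sum.cong) (auto simp: tr)
  also have "\<dots> = f x * of_nat N" using fin x by simp
  finally show ?thesis using fin by (auto simp: N_def)
qed

end

section \<open>Zeros of nonlinear characters\<close>

text \<open>Raising to the power \<open>k\<close> is a character of the group of n-th roots of
  unity: if it is nontrivial at \<open>w\<close>, multiplying by \<open>w\<close> permutes the roots
  and forces the sum to be zero.\<close>

lemma sum_roots_unity_Ints:
  assumes "n > 0"
  shows "(\<Sum>z | z ^ n = (1::complex). z ^ k) \<in> \<int>"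
proof (cases "\<forall>w. w ^ n = (1::complex) \<longrightarrow> w ^ k = 1")
  case True
  hence "(\<Sum>z | z ^ n = (1::complex). z ^ k) = (\<Sum>z | z ^ n = (1::complex). 1)"
    by (intro sum.cong) auto
  thus ?thesis by simp
next
  case False
  then obtain w where w: "w ^ n = (1::complex)" "w ^ k \<noteq> 1" by blast
  have "w \<noteq> 0" using w assms by (auto simp: power_0_left)
  have "(\<Sum>z | z ^ n = (1::complex). z ^ k) = (\<Sum>z | z ^ n = (1::complex). (w * z) ^ k)"
    by (rule sum.reindex_bij_witness[of _ "\<lambda>z. w * z" "\<lambda>z. z / w"])
       (use w \<open>w \<noteq> 0\<close> in \<open>auto simp: power_mult_distrib power_divide\<close>)
  also have "\<dots> = w ^ k * (\<Sum>z | z ^ n = (1::complex). z ^ k)"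
    by (simp add: power_mult_distrib sum_distrib_left)
  finally have "(\<Sum>z | z ^ n = (1::complex). z ^ k) = 0" using w(2) by auto
  thus ?thesis by simp
qed

section \<open>Sums over primitive roots of unity\<close>

definition primitive_roots :: "nat \<Rightarrow> complex set" where
  "primitive_roots n = {z. z ^ n = 1 \<and> (\<forall>m. 0 < m \<and> m < n \<longrightarrow> z ^ m \<noteq> 1)}"

lemma finite_primitive_roots: "n > 0 \<Longrightarrow> finite (primitive_roots n)"
  by (rule finite_subset[OF _ finite_roots_unity[of n]]) (auto simp: primitive_roots_def)

lemma root_unity_power_gcd:
  fixes z :: complex
  assumes "z ^ a = 1" "z ^ b = 1"
  shows "z ^ gcd a b = 1"
  using assms
proof (induction a b rule: gcd_nat_induct)
  case (step m n)
  have "z ^ m = z ^ (n * (m div n) + m mod n)" by simp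
  also have "\<dots> = z ^ (m mod n)" using step by (simp only: power_add power_mult) simp
  finally show ?case using step gcd_red_nat[of m n] by simp
qed simp

lemma roots_unity_primitive:
  assumes "n > 0"
  shows "{z. z ^ n = (1::complex)} = (\<Union>d\<in>{d. d dvd n}. primitive_roots d)"
proof safe
  fix z :: complex assume z: "z ^ n = 1"
  define d where "d = (LEAST d. d > 0 \<and> z ^ d = 1)"
  have d: "d > 0" "z ^ d = 1" using LeastI[of "\<lambda>d. d > 0 \<and> z ^ d = 1" n] z assms by (auto simp: d_def)
  have min: "z ^ m \<noteq> 1" if "0 < m" "m < d" for m
    using that not_less_Least[of m "\<lambda>d. d > 0 \<and> z ^ d = 1"] by (auto simp: d_def)
  have "gcd d n = d"
  proof (rule ccontr)
    assume "gcd d n \<noteq> d"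
    moreover have "gcd d n \<le> d" using d(1) by (intro gcd_le1_nat) simp
    ultimately have "gcd d n < d" by (rule le_neq_implies_less[rotated])
    thus False using min[of "gcd d n"] root_unity_power_gcd[OF d(2) z] d(1) by auto
  qed
  hence "d dvd n" by (metis gcd_dvd2)
  moreover have "z \<in> primitive_roots d" using d min by (auto simp: primitive_roots_def)
  ultimately show "z \<in> (\<Union>d\<in>{d. d dvd n}. primitive_roots d)" by blast
next
  fix z d assume "d dvd n" "z \<in> primitive_roots d"
  thus "z ^ n = 1" by (auto simp: primitive_roots_def power_mult elim!: dvdE)
qed

lemma root_unity_eq_cis_power:
  assumes "n > 0" "z ^ n = (1::complex)"
  obtains j where "z = cis (2 * pi / n) ^ j"
proof -
  have "z \<in> (\<lambda>k. cis (2 * pi * real k / real n)) ` {..<n}"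
    using bij_betw_imp_surj_on[OF bij_betw_roots_unity[OF assms(1)]] assms(2) by simp
  then obtain j where "z = cis (2 * pi * real j / real n)" by blast
  hence "z = cis (2 * pi / n) ^ j" by (simp add: DeMoivre mult_ac)
  thus ?thesis by (rule that)
qed

text \<open>Splitting the sum over all n-th roots of unity by exact order expresses the primitive
  part through proper divisors of \<open>n\<close>, so induction stays within the integers.\<close>

lemma ramanujan_sum_Ints:
  assumes "n > 0"
  shows "(\<Sum>z\<in>primitive_roots n. z ^ k) \<in> \<int>"
  using assms
proof (induction n rule: less_induct)
  case (less n)
  have fD: "finite {d. d dvd n}" using less.prems by simp
  have pos: "d > 0" if "d dvd n" for d using that less.prems by (auto intro: Nat.gr0I)
  have "(\<Sum>z | z ^ n = (1::complex). z ^ k) = (\<Sum>d | d dvd n. \<Sum>z\<in>primitive_roots d. z ^ k)"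
    unfolding roots_unity_primitive[OF less.prems]
  proof (rule sum.UNION_disjoint[OF fD])
    show "\<forall>d\<in>{d. d dvd n}. finite (primitive_roots d)" using pos finite_primitive_roots by auto
    show "\<forall>i\<in>{d. d dvd n}. \<forall>j\<in>{d. d dvd n}. i \<noteq> j \<longrightarrow> primitive_roots i \<inter> primitive_roots j = {}"
    proof (intro ballI impI equals0I)
      fix i j z assume "i \<in> {d. d dvd n}" "j \<in> {d. d dvd n}" "i \<noteq> j"
        "z \<in> primitive_roots i \<inter> primitive_roots j"
      thus False using pos by (auto simp: primitive_roots_def) (metis nat_neq_iff)
    qed
  qed
  also have "\<dots> = (\<Sum>z\<in>primitive_roots n. z ^ k) + (\<Sum>d\<in>{d. d dvd n} - {n}. \<Sum>z\<in>primitive_roots d. z ^ k)"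
    using fD by (intro sum.remove) auto
  finally have "(\<Sum>z\<in>primitive_roots n. z ^ k) =
     (\<Sum>z | z ^ n = (1::complex). z ^ k) - (\<Sum>d\<in>{d. d dvd n} - {n}. \<Sum>z\<in>primitive_roots d. z ^ k)"
    by simp
  also have "\<dots> \<in> \<int>"
  proof -
    have "(\<Sum>z\<in>primitive_roots d. z ^ k) \<in> \<int>" if d: "d \<in> {d. d dvd n} - {n}" for d
      using d pos less.prems by (intro less.IH) (auto dest!: dvd_imp_le)
    hence "(\<Sum>d\<in>{d. d dvd n} - {n}. \<Sum>z\<in>primitive_roots d. z ^ k) \<in> \<int>" by (rule Ints_sum)
    thus ?thesis by (intro Ints_diff sum_roots_unity_Ints less.prems)
  qed
  finally show ?case .
qed

text \<open>Summing \<open>F ^ m\<close> over the primitive roots of unity shows that \<open>c * P ^ m\<close> is an integer for all \<open>m\<close>,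
  with \<open>c\<close> independent of \<open>m\<close>. This avoids any appeal to algebraic integers.\<close>

lemma norm_ge_1_if_Galois_invariant:
  fixes F :: "int poly" and P :: complex
  assumes n: "n > 0" and inv: "\<And>z. z \<in> primitive_roots n \<Longrightarrow> poly (of_int_poly F) z = P"
    and "P \<noteq> 0"
  shows "norm P \<ge> 1"
proof (rule ccontr)
  assume "\<not> norm P \<ge> 1"
  hence lt: "norm P < 1" by simp
  define c where "c = card (primitive_roots n)"
  \<comment> \<open>Ensures that the factor \<open>c\<close> is not zero.\<close>
  have "cis (2 * pi / n) \<in> primitive_roots n"
  proof -
    have "cis (2 * pi / n) ^ m \<noteq> 1" if m: "0 < m" "m < n" for m
    proof
      assume "cis (2 * pi / n) ^ m = 1"
      hence "cis (2 * pi * real m / real n) = cis (2 * pi * real 0 / real n)"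
        by (simp add: DeMoivre mult_ac)
      with bij_betw_roots_unity[OF n] have "m = 0"
        using m n unfolding bij_betw_def inj_on_def by blast
      thus False using m by simp
    qed
    moreover have "cis (2 * pi / n) ^ n = 1" using n by (simp add: DeMoivre)
    ultimately show ?thesis by (auto simp: primitive_roots_def)
  qed
  hence c: "c > 0" using finite_primitive_roots[OF n] by (auto simp: c_def card_gt_0_iff)
  have int: "of_nat c * P ^ m \<in> \<int>" for m
  proof -
    have "of_nat c * P ^ m = (\<Sum>z\<in>primitive_roots n. poly (of_int_poly (F ^ m)) z)"
      by (simp add: inv c_def of_int_poly_hom.hom_power)
    also have "\<dots> = (\<Sum>z\<in>primitive_roots n. \<Sum>i\<le>degree (F ^ m). of_int (poly.coeff (F ^ m) i) * z ^ i)"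
      by (simp add: poly_altdef)
    also have "\<dots> = (\<Sum>i\<le>degree (F ^ m). of_int (poly.coeff (F ^ m) i) * (\<Sum>z\<in>primitive_roots n. z ^ i))"
      by (subst sum.swap) (simp add: sum_distrib_left)
    also have "\<dots> \<in> \<int>"
      by (intro Ints_sum Ints_mult ramanujan_sum_Ints n) auto
    finally show ?thesis .
  qed
  \<comment> \<open>With the norm of \<open>P\<close> below 1, the integers \<open>c * P ^ m\<close>
    would tend to 0 without ever being 0.\<close>
  have "(\<lambda>m. real c * norm P ^ m) \<longlonglongrightarrow> real c * 0"
    using lt by (intro tendsto_intros LIMSEQ_realpow_zero) auto
  hence "eventually (\<lambda>m. real c * norm P ^ m < 1) sequentially"
    by (rule order_tendstoD) simp
  then obtain m where m: "real c * norm P ^ m < 1" by (auto simp: eventually_sequentially)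
  have "norm (of_nat c * P ^ m) < 1" using m by (simp add: norm_mult norm_power)
  moreover have "of_nat c * P ^ m \<noteq> 0" using c \<open>P \<noteq> 0\<close> by simp
  moreover obtain i where i: "of_nat c * P ^ m = of_int i" using int[of m] by (auto elim: Ints_cases)
  ultimately have "\<bar>i\<bar> < 1" "i \<noteq> 0" unfolding i by auto
  thus False by simp
qed

lemma upper_triangular_mult_diag:
  assumes "A \<in> carrier_mat n n" "B \<in> carrier_mat n n" "upper_triangular A" "upper_triangular B"
  shows "upper_triangular (A * B :: 'a::comm_ring_1 mat)" "\<And>i. i < n \<Longrightarrow> (A * B) $$ (i,i) = A $$ (i,i) * B $$ (i,i)"
proof -
  have e: "(A * B) $$ (i,j) = (\<Sum>k<n. A $$ (i,k) * B $$ (k,j))" if "i < n" "j < n" for i j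
    using assms that by (simp add: scalar_prod_def atLeast0LessThan)
  have z: "A $$ (i,k) * B $$ (k,j) = 0" if "i < n" "k < n" "j \<le> i" "k \<noteq> i \<or> j < i" for i j k
    using that assms by (cases "k < i") (auto simp: upper_triangular_def)
  show "upper_triangular (A * B)"
    using assms by (auto simp: upper_triangular_def e z simp del: index_mult_mat(1) intro!: sum.neutral)
  show "(A * B) $$ (i,i) = A $$ (i,i) * B $$ (i,i)" if i: "i < n" for i
  proof -
    have "(A * B) $$ (i,i) = (\<Sum>k<n. if k = i then A $$ (i,i) * B $$ (i,i) else 0)"
      using i by (simp only: e) (intro sum.cong, auto simp: z)
    thus ?thesis using i by simp
  qed
qed

lemma upper_triangular_pow_diag:
  assumes "A \<in> carrier_mat n n" "upper_triangular (A :: 'a::comm_ring_1 mat)"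
  shows "upper_triangular (A ^\<^sub>m k) \<and> (\<forall>i<n. (A ^\<^sub>m k) $$ (i,i) = (A $$ (i,i)) ^ k)"
proof (induction k)
  case (Suc k)
  thus ?case using upper_triangular_mult_diag[of "A ^\<^sub>m k" n A] assms by (simp add: mult.commute)
qed (use assms in \<open>auto simp: upper_triangular_def\<close>)

section \<open>Character values and Burnside's theorem on zeros\<close>

context fin_group
begin

lemma rep_pow:
  assumes "representation G n \<rho>" "g \<in> carrier G"
  shows "\<rho> (g [^] (k::nat)) = \<rho> g ^\<^sub>m k"
  using assms rep_carrier[OF assms] by (induction k) (auto simp: rep_one rep_mult)

lemma pow_order_1: "g \<in> carrier G \<Longrightarrow> g [^] Coset.order G = \<one>"
  using pow_order_eq_1 by blast

lemma order_pos: "Coset.order G > 0"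
  using fin order_gt_0_iff_finite by blast

text \<open>Triangularising \<open>\<rho> g\<close> once gives eigenvalues that serve all powers of
  \<open>g\<close> simultaneously; this uniformity in \<open>k\<close> is what makes power maps act
  like Galois conjugation.\<close>

lemma character_eigenvalues:
  assumes \<rho>: "representation G n \<rho>" and g: "g \<in> carrier G"
  obtains e where "\<And>i. i < n \<Longrightarrow> e i ^ Coset.order G = 1"
    "\<And>k. mat_trace (\<rho> (g [^] (k::nat))) = (\<Sum>i<n. e i ^ k)"
proof -
  note A = rep_carrier[OF \<rho> g]
  obtain as where "char_poly (\<rho> g) = (\<Prod>a\<leftarrow>as. [:- a, 1:])"
    using char_poly_factorized[OF A] by blast
  from schur_decomposition_exists[OF A this] obtain B where
    B: "B \<in> carrier_mat n n" "upper_triangular B" "similar_mat (\<rho> g) B" by blast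
  then obtain P Q where w: "similar_mat_wit (\<rho> g) B P Q" unfolding similar_mat_def by blast
  from similar_mat_witD2[OF A w] have PQ: "P \<in> carrier_mat n n" "Q \<in> carrier_mat n n"
    "P * Q = 1\<^sub>m n" "Q * P = 1\<^sub>m n" by auto
  have pw: "\<rho> (g [^] k) = P * B ^\<^sub>m k * Q" for k
    using similar_mat_wit_pow_id[OF w] by (simp add: rep_pow[OF \<rho> g])
  have tr: "mat_trace (\<rho> (g [^] k)) = (\<Sum>i<n. (B $$ (i,i)) ^ k)" for k :: nat
  proof -
    have Bk: "B ^\<^sub>m k \<in> carrier_mat n n" using B by simp
    show ?thesis unfolding pw mat_trace_conj[OF Bk PQ(2,1,4)]
      using upper_triangular_pow_diag[OF B(1,2), of k] Bk B(1) by (simp add: mat_trace_sum)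
  qed
  \<comment> \<open>Undoing the conjugation turns \<open>g [^] Coset.order G = \<one>\<close> into a
    statement about the diagonal of \<open>B\<close>.\<close>
  have "B ^\<^sub>m Coset.order G = Q * (P * B ^\<^sub>m Coset.order G * Q) * P"
  proof -
    have Bk: "B ^\<^sub>m Coset.order G \<in> carrier_mat n n" using B by simp
    have "Q * (P * B ^\<^sub>m Coset.order G * Q) * P = (Q * P) * B ^\<^sub>m Coset.order G * (Q * P)"
      using PQ(1,2) Bk by (simp add: assoc_mult_mat[of _ n n _ n _ n])
    thus ?thesis by (simp only: PQ(4) left_mult_one_mat[OF Bk] right_mult_one_mat[OF Bk])
  qed
  also have "\<dots> = 1\<^sub>m n" using PQ by (simp flip: pw add: pow_order_1[OF g] rep_one[OF \<rho>])
  finally have "B ^\<^sub>m Coset.order G = 1\<^sub>m n" .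
  hence "(B $$ (i,i)) ^ Coset.order G = 1" if "i < n" for i
    using upper_triangular_pow_diag[OF B(1,2), of "Coset.order G"] that by auto
  with tr show ?thesis by (intro that[of "\<lambda>i. B $$ (i,i)"])
qed

text \<open>The inverse is the power with exponent \<open>Coset.order G - 1\<close>, and an
  eigenvalue of norm 1 has its conjugate as inverse.\<close>

lemma trace_inv:
  assumes \<rho>: "representation G n \<rho>" and g: "g \<in> carrier G"
  shows "mat_trace (\<rho> (inv g)) = cnj (mat_trace (\<rho> g))"
proof -
  obtain e where e: "\<And>i. i < n \<Longrightarrow> e i ^ Coset.order G = 1"
    "\<And>k. mat_trace (\<rho> (g [^] (k::nat))) = (\<Sum>i<n. e i ^ k)"
    using character_eigenvalues[OF assms] by metis
  obtain m where m: "Coset.order G = Suc m" using order_pos by (cases "Coset.order G") auto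
  have "g [^] m \<otimes> g = \<one>" using pow_order_1[OF g] m by simp
  hence "inv g = g [^] m" using g by (metis inv_equality nat_pow_closed)
  hence "mat_trace (\<rho> (inv g)) = (\<Sum>i<n. e i ^ m)" using e by simp
  also have "\<dots> = (\<Sum>i<n. cnj (e i))"
  proof (rule sum.cong)
    fix i assume "i \<in> {..<n}"
    hence ei: "e i ^ Suc m = 1" using e m by simp
    hence "norm (e i) = 1" using power_eq_1_iff[OF ei] by simp
    hence "e i * cnj (e i) = 1" by (simp flip: complex_norm_square)
    moreover have "e i * e i ^ m = 1" using ei by simp
    ultimately show "e i ^ m = cnj (e i)" by (metis mult.left_commute mult_1_right)
  qed simp
  also have "\<dots> = cnj (mat_trace (\<rho> g))" using e(2)[of 1] g by simp
  finally show ?thesis .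
qed

text \<open>Every eigenvalue is a power of one root of unity; passing from \<open>g\<close> to
  \<open>g [^] k\<close> substitutes its k-th power into the same integer polynomial.\<close>

lemma character_poly:
  assumes \<rho>: "representation G n \<rho>" and g: "g \<in> carrier G"
  obtains p :: "int poly" where
    "\<And>k. mat_trace (\<rho> (g [^] (k::nat))) = poly (of_int_poly p) (cis (2 * pi / Coset.order G) ^ k)"
proof -
  define \<zeta> where "\<zeta> = cis (2 * pi / Coset.order G)"
  obtain e where e: "\<And>i. i < n \<Longrightarrow> e i ^ Coset.order G = 1"
    "\<And>k. mat_trace (\<rho> (g [^] (k::nat))) = (\<Sum>i<n. e i ^ k)"
    using character_eigenvalues[OF assms] by metis
  have "\<exists>j. e i = \<zeta> ^ j" if "i < n" for i
  proof -
    have "e i ^ Coset.order G = 1" using e that by simp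
    thus ?thesis using root_unity_eq_cis_power[OF order_pos] unfolding \<zeta>_def by blast
  qed
  then obtain j where j: "\<And>i. i < n \<Longrightarrow> e i = \<zeta> ^ j i" by metis
  define p :: "int poly" where "p = (\<Sum>i<n. Polynomial.monom 1 (j i))"
  have "mat_trace (\<rho> (g [^] k)) = poly (of_int_poly p) (\<zeta> ^ k)" for k :: nat
  proof -
    have "poly (of_int_poly p) (\<zeta> ^ k) = (\<Sum>i<n. (\<zeta> ^ k) ^ j i)"
      by (simp add: p_def of_int_poly_hom.hom_sum poly_sum poly_monom)
    also have "\<dots> = (\<Sum>i<n. e i ^ k)"
      by (intro sum.cong) (auto simp: j simp flip: power_mult, simp add: mult.commute)
    finally show ?thesis using e by simp
  qed
  thus ?thesis using that unfolding \<zeta>_def by blast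
qed

lemma bij_betw_pow:
  assumes "coprime j (Coset.order G)"
  shows "bij_betw (\<lambda>g. g [^] (j::nat)) (carrier G) (carrier G)"
proof -
  define N where "N = Coset.order G"
  have N: "N > 0" using order_pos by (simp add: N_def)
  have pN: "g [^] (N * k) = \<one>" if "g \<in> carrier G" for g and k :: nat
    using that pow_order_1[OF that] by (simp add: N_def flip: nat_pow_pow)
  \<comment> \<open>\<open>j\<close> may be 0 in the trivial group, whereas Bezout's identity wants
    a nonzero number; adding \<open>N\<close> does not change powers.\<close>
  have "gcd (j + N) N = 1" using assms by (simp add: N_def)
  then obtain x y where xy: "(j + N) * x = N * y + 1"
    using bezout_nat[of "j + N" N] N by auto
  have "inj_on (\<lambda>g. g [^] j) (carrier G)"
  proof (rule inj_on_inverseI)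
    fix g assume g: "g \<in> carrier G"
    have "g [^] j = g [^] (j + N)" using g pN[OF g, of 1] by (simp flip: nat_pow_mult)
    hence "(g [^] j) [^] x = g [^] ((j + N) * x)" using g by (simp add: nat_pow_pow)
    also have "\<dots> = g" unfolding xy using g pN[OF g] by (simp flip: nat_pow_mult)
    finally show "(g [^] j) [^] x = g" .
  qed
  thus ?thesis using endo_inj_surj[OF fin, of "\<lambda>g. g [^] j"] by (auto simp: bij_betw_def)
qed

text \<open>If there were no zero, the product of all character values would have norm at least 1, and the
  arithmetic-geometric mean inequality (in the form \<open>ln x \<le> x - 1\<close>) would contradict the first
  orthogonality relation at the identity.\<close>

theorem burnside_zero:
  assumes \<rho>: "irreducible_representation G n \<rho>" and n: "n > 1"
  shows "\<exists>g\<in>carrier G. mat_trace (\<rho> g) = 0"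
proof (rule ccontr)
  assume "\<not> ?thesis"
  hence nz: "mat_trace (\<rho> g) \<noteq> 0" if "g \<in> carrier G" for g using that by blast
  note rr = irr_rep[OF \<rho>]
  define P where "P = (\<Prod>g\<in>carrier G. mat_trace (\<rho> g))"
  define \<zeta> where "\<zeta> = cis (2 * pi / Coset.order G)"
  have "\<forall>g\<in>carrier G. \<exists>p :: int poly. \<forall>k::nat. mat_trace (\<rho> (g [^] k)) = poly (of_int_poly p) (\<zeta> ^ k)"
    using character_poly[OF rr] unfolding \<zeta>_def by metis
  then obtain p :: "'a \<Rightarrow> int poly" where
    p: "\<And>g k. g \<in> carrier G \<Longrightarrow> mat_trace (\<rho> (g [^] (k::nat))) = poly (of_int_poly (p g)) (\<zeta> ^ k)"
    by metis
  define F where "F = (\<Prod>g\<in>carrier G. p g)"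
  \<comment> \<open>Galois invariance of \<open>P\<close>: substituting \<open>\<zeta> ^ j\<close>
    for \<open>\<zeta>\<close> replaces each \<open>g\<close> by \<open>g [^] j\<close>, which
    permutes the group because \<open>j\<close> is coprime to its order.\<close>
  have "poly (of_int_poly F) z = P" if z: "z \<in> primitive_roots (Coset.order G)" for z
  proof -
    have "z ^ Coset.order G = 1" using z by (simp add: primitive_roots_def)
    then obtain j where j: "z = \<zeta> ^ j"
      using root_unity_eq_cis_power[OF order_pos] unfolding \<zeta>_def by blast
    have \<zeta>1: "\<zeta> ^ Coset.order G = 1" using order_pos by (simp add: \<zeta>_def DeMoivre)
    \<comment> \<open>A common divisor of \<open>j\<close> and the group order would make a smaller
      power of \<open>z\<close> equal to 1.\<close>
    have "coprime j (Coset.order G)"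
    proof (rule ccontr)
      define d where "d = gcd j (Coset.order G)"
      assume "\<not> coprime j (Coset.order G)"
      hence d1: "d \<noteq> 1" by (simp add: d_def coprime_iff_gcd_eq_1)
      have d0: "d > 0" using order_pos by (simp add: d_def)
      have "d dvd j" "d dvd Coset.order G" by (simp_all add: d_def)
      then obtain a b where ab: "j = d * a" "Coset.order G = d * b" by (metis dvdE)
      have "z ^ b = (\<zeta> ^ Coset.order G) ^ a" by (simp add: j ab mult_ac flip: power_mult)
      hence "z ^ b = 1" using \<zeta>1 by simp
      moreover have "0 < b" "b < Coset.order G" using ab d0 d1 order_pos by (auto intro: Nat.gr0I)
      ultimately show False using z by (auto simp: primitive_roots_def)
    qed
    have "poly (of_int_poly F) z = (\<Prod>g\<in>carrier G. mat_trace (\<rho> (g [^] j)))"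
      by (simp add: F_def of_int_poly_hom.hom_prod poly_prod j p)
    also have "\<dots> = P" unfolding P_def
      by (rule prod.reindex_bij_betw[OF bij_betw_pow[OF \<open>coprime j (Coset.order G)\<close>]])
    finally show ?thesis .
  qed
  moreover have "P \<noteq> 0" using nz fin by (simp add: P_def)
  ultimately have P1: "norm P \<ge> 1" by (rule norm_ge_1_if_Galois_invariant[OF order_pos])
  define a where "a = (\<lambda>g. (norm (mat_trace (\<rho> g)))\<^sup>2)"
  have apos: "a g > 0" if "g \<in> carrier G" for g using nz[OF that] by (simp add: a_def)
  have "complex_of_real (\<Sum>g\<in>carrier G. a g) = (\<Sum>g\<in>carrier G. mat_trace (\<rho> g) * mat_trace (\<rho> (inv g)))"
    by (simp add: a_def trace_inv[OF rr] flip: complex_norm_square)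
  also have "\<dots> = of_nat (card (carrier G))" by (rule orthogonality_same[OF \<rho>])
  finally have suma: "(\<Sum>g\<in>carrier G. a g) = real (card (carrier G))"
    by (metis of_real_eq_iff of_real_of_nat_eq)
  have "(\<Sum>g\<in>carrier G. ln (a g)) = ln (\<Prod>g\<in>carrier G. a g)"
    by (rule ln_prod[OF fin, symmetric]) (metis apos less_irrefl)
  also have "(\<Prod>g\<in>carrier G. a g) = (norm P)\<^sup>2"
    by (simp add: a_def P_def prod_power_distrib flip: prod_norm)
  also have "ln ((norm P)\<^sup>2) \<ge> 0" using P1 by simp
  finally have ln0: "(\<Sum>g\<in>carrier G. ln (a g)) \<ge> 0" .
  \<comment> \<open>Strictness comes from the identity, where \<open>a\<close> is the square of the
    degree and differs from 1.\<close>
  have a1: "a \<one> = (real n)\<^sup>2" by (simp add: a_def rep_one[OF rr] mat_trace_one)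
  have "a \<one> \<noteq> 1" using n by (simp add: a1 power2_eq_1_iff)
  hence "ln (a \<one>) < a \<one> - 1"
    using ln_le_minus_one[of "a \<one>"] ln_eq_minus_one[of "a \<one>"] apos[of \<one>] by fastforce
  hence "(\<Sum>g\<in>carrier G. ln (a g)) < (\<Sum>g\<in>carrier G. a g - 1)"
    using fin apos ln_le_minus_one by (intro sum_strict_mono_ex1) auto
  also have "\<dots> = 0" by (simp add: sum_subtractf suma)
  finally show False using ln0 by simp
qed

end

section \<open>Characters, classes and linear characters\<close>

definition linear_chars :: "('a, 'b) monoid_scheme \<Rightarrow> ('a \<Rightarrow> complex) set" where
  "linear_chars G = {\<chi> \<in> Irr G. \<chi> \<one>\<^bsub>G\<^esub> = 1}"

definition conj_class :: "('a, 'b) monoid_scheme \<Rightarrow> 'a \<Rightarrow> 'a set" where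
  "conj_class G x = {g \<otimes>\<^bsub>G\<^esub> x \<otimes>\<^bsub>G\<^esub> inv\<^bsub>G\<^esub> g | g. g \<in> carrier G}"

context fin_group
begin

lemma IrrE:
  assumes "\<chi> \<in> Irr G"
  obtains n \<rho> where "irreducible_representation G n \<rho>" "\<chi> = character G \<rho>"
    "\<And>g. g \<in> carrier G \<Longrightarrow> \<chi> g = mat_trace (\<rho> g)"
  using assms by (auto simp: Irr_def character_def)

lemma Irr_extensional: "\<chi> \<in> Irr G \<Longrightarrow> \<chi> \<in> extensional (carrier G)"
  by (auto simp: Irr_def character_def)

lemma Irr_class:
  assumes "\<chi> \<in> Irr G" and g: "g \<in> carrier G" and h: "h \<in> carrier G"
  shows "\<chi> (h \<otimes> g \<otimes> inv h) = \<chi> g"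
proof -
  obtain n \<rho> where \<rho>: "irreducible_representation G n \<rho>"
    and \<chi>: "\<And>g. g \<in> carrier G \<Longrightarrow> \<chi> g = mat_trace (\<rho> g)" using IrrE[OF assms(1)] by metis
  note rr = irr_rep[OF \<rho>]
  have "\<rho> h * \<rho> (inv h) = 1\<^sub>m n" using h by (simp flip: rep_mult[OF rr] add: rep_one[OF rr])
  moreover have "\<rho> (inv h) * \<rho> h = 1\<^sub>m n" using h by (simp flip: rep_mult[OF rr] add: rep_one[OF rr])
  ultimately show ?thesis
    using mat_trace_conj[of "\<rho> g" n "\<rho> (inv h)" "\<rho> h"] g h rep_carrier[OF rr]
    by (simp add: \<chi> rep_mult[OF rr])
qed

lemma Irr_inv:
  assumes "\<chi> \<in> Irr G" and g: "g \<in> carrier G"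
  shows "\<chi> (inv g) = cnj (\<chi> g)"
  using assms(1) by (rule IrrE) (simp add: g trace_inv[OF irr_rep])

lemma Irr_one: "\<chi> \<in> Irr G \<Longrightarrow> \<exists>n>0. \<chi> \<one> = of_nat n"
  by (erule IrrE) (use irr_pos in \<open>auto simp: rep_one[OF irr_rep] mat_trace_one\<close>)

lemma nonlinear_Irr_has_zero:
  assumes "\<chi> \<in> Irr G" "\<chi> \<notin> linear_chars G"
  shows "\<exists>g\<in>carrier G. \<chi> g = 0"
proof -
  obtain n \<rho> where \<rho>: "irreducible_representation G n \<rho>"
    and \<chi>: "\<And>g. g \<in> carrier G \<Longrightarrow> \<chi> g = mat_trace (\<rho> g)" using IrrE[OF assms(1)] by metis
  have "n \<noteq> 1" using assms \<chi>[of \<one>] rep_one[OF irr_rep[OF \<rho>]] by (auto simp: linear_chars_def mat_trace_one)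
  hence "n > 1" using irr_pos[OF \<rho>] by simp
  from burnside_zero[OF \<rho> this] show ?thesis using \<chi> by auto
qed

section \<open>Bessel's inequality and the number of irreducible characters\<close>

definition inner :: "('a \<Rightarrow> complex) \<Rightarrow> ('a \<Rightarrow> complex) \<Rightarrow> complex" where
  "inner f h = (\<Sum>g\<in>carrier G. f g * cnj (h g))"

lemma inner_Irr:
  assumes "\<chi> \<in> Irr G" "\<psi> \<in> Irr G"
  shows "inner \<chi> \<psi> = (if \<chi> = \<psi> then of_nat (card (carrier G)) else 0)"
proof -
  obtain n \<rho> where \<rho>: "irreducible_representation G n \<rho>" "\<chi> = character G \<rho>"
    and \<chi>: "\<And>g. g \<in> carrier G \<Longrightarrow> \<chi> g = mat_trace (\<rho> g)" using IrrE[OF assms(1)] by metis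
  obtain m \<sigma> where \<sigma>: "irreducible_representation G m \<sigma>" "\<psi> = character G \<sigma>"
    and \<psi>: "\<And>g. g \<in> carrier G \<Longrightarrow> \<psi> g = mat_trace (\<sigma> g)" using IrrE[OF assms(2)] by metis
  have "inner \<chi> \<psi> = (\<Sum>g\<in>carrier G. mat_trace (\<rho> g) * mat_trace (\<sigma> (inv g)))"
    by (simp add: inner_def \<chi> \<psi> trace_inv[OF irr_rep[OF \<sigma>(1)]])
  moreover have "\<dots> = 0" if "\<chi> \<noteq> \<psi>"
    using orthogonality_distinct[OF \<sigma>(1) \<rho>(1)] \<rho>(2) \<sigma>(2) that by simp
  moreover have "inner \<chi> \<chi> = (\<Sum>g\<in>carrier G. mat_trace (\<rho> g) * mat_trace (\<rho> (inv g)))"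
    by (simp add: inner_def \<chi> trace_inv[OF irr_rep[OF \<rho>(1)]])
  ultimately show ?thesis using orthogonality_same[OF \<rho>(1)] by auto
qed

text \<open>\<open>h\<close> is the error of the orthogonal projection of \<open>f\<close> to the
  span of \<open>S\<close>. Its norm identity gives Bessel's inequality in general and Parseval's
  identity once \<open>h\<close> vanishes.\<close>

lemma projection_residual:
  fixes f :: "'a \<Rightarrow> complex"
  assumes S: "finite S" "S \<subseteq> Irr G"
  defines "h \<equiv> \<lambda>g. f g - (\<Sum>\<chi>\<in>S. inner f \<chi> / of_nat (card (carrier G)) * \<chi> g)"
  shows "\<chi> \<in> S \<Longrightarrow> inner h \<chi> = 0"
    and "inner h h = inner f f - (\<Sum>\<chi>\<in>S. inner f \<chi> * cnj (inner f \<chi>)) / of_nat (card (carrier G))"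
proof -
  define N :: complex where "N = of_nat (card (carrier G))"
  have N: "N \<noteq> 0" using fin by (auto simp: N_def)
  define c where "c = (\<lambda>\<chi>. inner f \<chi> / N)"
  define u where "u = (\<lambda>g. \<Sum>\<chi>\<in>S. c \<chi> * \<chi> g)"
  have h: "h = (\<lambda>g. f g - u g)" by (simp add: h_def u_def c_def N_def)
  have uip: "inner u k = (\<Sum>\<chi>\<in>S. c \<chi> * inner \<chi> k)" for k
    unfolding inner_def u_def sum_distrib_left sum_distrib_right
    by (subst sum.swap) (simp add: mult.assoc)
  have hip: "inner h k = inner f k - inner u k" for k by (simp add: h inner_def left_diff_distrib sum_subtractf)
  have cs: "cnj (inner l k) = inner k l" for k l by (simp add: inner_def mult.commute)
  have orth: "inner h \<psi> = 0" if "\<psi> \<in> S" for \<psi>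
  proof -
    have "inner u \<psi> = (\<Sum>\<chi>\<in>S. if \<chi> = \<psi> then inner f \<psi> else 0)"
      unfolding uip using that S N by (intro sum.cong) (auto simp: inner_Irr subset_iff N_def c_def)
    thus ?thesis using that S by (simp add: hip)
  qed
  thus "\<chi> \<in> S \<Longrightarrow> inner h \<chi> = 0" .
  have "inner \<chi> h = 0" if "\<chi> \<in> S" for \<chi> using orth[OF that] cs[of h \<chi>] by simp
  hence "inner u h = 0" by (simp add: uip)
  have "inner h h = inner f h" using hip[of h] \<open>inner u h = 0\<close> by simp
  also have "\<dots> = cnj (inner h f)" by (simp add: cs)
  also have "\<dots> = inner f f - cnj (inner u f)" by (simp add: hip cs)
  also have "inner u f = (\<Sum>\<chi>\<in>S. inner f \<chi> * cnj (inner f \<chi>)) / N"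
    by (simp add: uip cs c_def sum_divide_distrib)
  also have "cnj \<dots> = \<dots>" by (simp add: N_def mult.commute)
  finally show "inner h h = inner f f - (\<Sum>\<chi>\<in>S. inner f \<chi> * cnj (inner f \<chi>)) / of_nat (card (carrier G))"
    by (simp add: N_def)
qed

lemma inner_self: "inner h h = of_real (\<Sum>g\<in>carrier G. (norm (h g))\<^sup>2)"
  by (simp add: inner_def flip: complex_norm_square)

lemma bessel:
  assumes "finite S" "S \<subseteq> Irr G"
  shows "(\<Sum>\<chi>\<in>S. (norm (inner f \<chi>))\<^sup>2) \<le> real (card (carrier G)) * (\<Sum>g\<in>carrier G. (norm (f g))\<^sup>2)"
proof -
  define h where "h = (\<lambda>g. f g - (\<Sum>\<chi>\<in>S. inner f \<chi> / of_nat (card (carrier G)) * \<chi> g))"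
  have "complex_of_real (\<Sum>g\<in>carrier G. (norm (h g))\<^sup>2) =
     of_real ((\<Sum>g\<in>carrier G. (norm (f g))\<^sup>2) - (\<Sum>\<chi>\<in>S. (norm (inner f \<chi>))\<^sup>2) / real (card (carrier G)))"
    using projection_residual(2)[OF assms, of f, folded h_def] unfolding inner_self
    by (simp flip: complex_norm_square)
  hence "(\<Sum>g\<in>carrier G. (norm (f g))\<^sup>2) - (\<Sum>\<chi>\<in>S. (norm (inner f \<chi>))\<^sup>2) / real (card (carrier G)) =
     (\<Sum>g\<in>carrier G. (norm (h g))\<^sup>2)" unfolding of_real_eq_iff by simp
  also have "\<dots> \<ge> 0" by (intro sum_nonneg) auto
  finally have "(\<Sum>\<chi>\<in>S. (norm (inner f \<chi>))\<^sup>2) / real (card (carrier G)) \<le> (\<Sum>g\<in>carrier G. (norm (f g))\<^sup>2)"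
    by simp
  moreover have "real (card (carrier G)) > 0" using fin by (auto simp: card_gt_0_iff)
  ultimately show ?thesis by (simp add: pos_divide_le_eq mult.commute)
qed

text \<open>Bessel's inequality for the indicator function of the identity: each irreducible
  character contributes the square of its degree, at least 1, so there are at most
  \<open>card (carrier G)\<close> of them.\<close>

lemma finite_Irr: "finite (Irr G)"
proof (rule ccontr)
  assume "infinite (Irr G)"
  then obtain S where S: "S \<subseteq> Irr G" "card S = Suc (card (carrier G))" "finite S"
    using infinite_arbitrarily_large by blast
  define f where "f = (\<lambda>g. if g = \<one> then 1 else 0 :: complex)"
  have fc: "inner f \<chi> = cnj (\<chi> \<one>)" for \<chi>
  proof -
    have "inner f \<chi> = (\<Sum>g\<in>carrier G. if g = \<one> then cnj (\<chi> g) else 0)"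
      unfolding inner_def f_def by (intro sum.cong) auto
    thus ?thesis using fin by simp
  qed
  have "real (card S) = (\<Sum>\<chi>\<in>S. 1)" by simp
  also have "\<dots> \<le> (\<Sum>\<chi>\<in>S. (norm (inner f \<chi>))\<^sup>2)"
    using S Irr_one by (intro sum_mono) (force simp: fc)
  also have "\<dots> \<le> real (card (carrier G)) * (\<Sum>g\<in>carrier G. (norm (f g))\<^sup>2)"
    by (rule bessel[OF S(3,1)])
  also have "(\<Sum>g\<in>carrier G. (norm (f g))\<^sup>2) = (\<Sum>g\<in>carrier G. if g = \<one> then 1 else 0)"
    by (intro sum.cong) (auto simp: f_def)
  also have "\<dots> = 1" using fin by simp
  finally show False using S(2) by simp
qed

lemma conj_class_self: "x \<in> carrier G \<Longrightarrow> x \<in> conj_class G x"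
  by (auto simp: conj_class_def intro!: exI[of _ \<one>])

lemma conj_class_carrier: "x \<in> carrier G \<Longrightarrow> conj_class G x \<subseteq> carrier G"
  by (auto simp: conj_class_def)

lemma conj_class_eq:
  assumes x: "x \<in> carrier G" and y: "y \<in> conj_class G x"
  shows "conj_class G y = conj_class G x"
proof -
  obtain g where g: "g \<in> carrier G" "y = g \<otimes> x \<otimes> inv g" using y by (auto simp: conj_class_def)
  have e1: "h \<otimes> y \<otimes> inv h = (h \<otimes> g) \<otimes> x \<otimes> inv (h \<otimes> g)" if "h \<in> carrier G" for h
    using that g x by (simp add: inv_mult_group m_assoc)
  have e2: "h \<otimes> x \<otimes> inv h = (h \<otimes> inv g) \<otimes> y \<otimes> inv (h \<otimes> inv g)" if "h \<in> carrier G" for h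
  proof -
    have "inv g \<otimes> (g \<otimes> z) = z" if "z \<in> carrier G" for z
      using that g(1) by (simp flip: m_assoc)
    thus ?thesis using that g x by (simp add: inv_mult_group m_assoc)
  qed
  show ?thesis
  proof (intro equalityI subsetI)
    fix v assume "v \<in> conj_class G y"
    then obtain h where "h \<in> carrier G" "v = h \<otimes> y \<otimes> inv h" by (auto simp: conj_class_def)
    thus "v \<in> conj_class G x" using e1 g(1) m_closed unfolding conj_class_def by blast
  next
    fix v assume "v \<in> conj_class G x"
    then obtain h where "h \<in> carrier G" "v = h \<otimes> x \<otimes> inv h" by (auto simp: conj_class_def)
    thus "v \<in> conj_class G y" using e2 g(1) m_closed inv_closed unfolding conj_class_def by blast
  qed
qed

lemma conjugacy_classes_eq: "conjugacy_classes G = conj_class G ` carrier G"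
  by (auto simp: conjugacy_classes_def orbits_def orbit_def conj_class_def)

lemma classes_disjoint:
  assumes "C \<in> conjugacy_classes G" "D \<in> conjugacy_classes G" "C \<noteq> D"
  shows "C \<inter> D = {}"
proof -
  obtain x y where "x \<in> carrier G" "C = conj_class G x" "y \<in> carrier G" "D = conj_class G y"
    using assms by (auto simp: conjugacy_classes_eq)
  thus ?thesis using conj_class_eq[of x] conj_class_eq[of y] assms(3) by (metis disjoint_iff)
qed

lemma finite_classes: "finite (conjugacy_classes G)"
  using fin by (simp add: conjugacy_classes_eq)

lemma Union_classes: "\<Union>(conjugacy_classes G) = carrier G"
proof
  show "\<Union>(conjugacy_classes G) \<subseteq> carrier G"
    unfolding conjugacy_classes_eq using conj_class_carrier by (intro Union_least) auto
  show "carrier G \<subseteq> \<Union>(conjugacy_classes G)"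
    unfolding conjugacy_classes_eq using conj_class_self by blast
qed

lemma Irr_conj_class:
  assumes "\<chi> \<in> Irr G" "x \<in> carrier G" "y \<in> conj_class G x"
  shows "\<chi> y = \<chi> x"
  using assms Irr_class by (auto simp: conj_class_def)

text \<open>Parseval's identity for the indicator function of a class, that is, column orthogonality
  in the diagonal case. Summing over the class, rather than multiplying by its size, suits the
  double count in \<open>card_Irr\<close>.\<close>

lemma column_norm:
  assumes x: "x \<in> carrier G"
  shows "(\<Sum>\<chi>\<in>Irr G. \<Sum>g\<in>conj_class G x. (norm (\<chi> g))\<^sup>2) = real (card (carrier G))"
proof -
  define N where "N = card (carrier G)"
  define C where "C = conj_class G x"
  have N: "N > 0" using fin by (auto simp: N_def card_gt_0_iff)
  have CG: "C \<subseteq> carrier G" using conj_class_carrier[OF x] by (simp add: C_def)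
  have fC: "finite C" using CG fin finite_subset by blast
  have C0: "card C > 0" using conj_class_self[OF x] fC by (auto simp: C_def card_gt_0_iff)
  define f where "f = (\<lambda>g. if g \<in> C then 1 else 0 :: complex)"
  define h where "h = (\<lambda>g. f g - (\<Sum>\<chi>\<in>Irr G. inner f \<chi> / of_nat (card (carrier G)) * \<chi> g))"
  have fcl: "f (k \<otimes> g \<otimes> inv k) = f g" if "g \<in> carrier G" "k \<in> carrier G" for g k
  proof -
    have "k \<otimes> g \<otimes> inv k \<in> conj_class G g" using that by (auto simp: conj_class_def)
    hence "conj_class G (k \<otimes> g \<otimes> inv k) = conj_class G g" using conj_class_eq that by blast
    hence "k \<otimes> g \<otimes> inv k \<in> C \<longleftrightarrow> g \<in> C"
      unfolding C_def using that conj_class_eq[OF x] conj_class_self by (metis inv_closed m_closed)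
    thus ?thesis by (simp add: f_def)
  qed
  have hcl: "h (k \<otimes> g \<otimes> inv k) = h g" if "g \<in> carrier G" "k \<in> carrier G" for g k
    using that by (simp add: h_def fcl Irr_class)
  \<comment> \<open>\<open>class_function_eq_0\<close> pairs without conjugation; composing with
    inversion turns this into the pairing \<open>inner\<close>.\<close>
  have "h (inv g) = 0" if g: "g \<in> carrier G" for g
  proof (rule class_function_eq_0[of "\<lambda>g. h (inv g)"])
    fix a b assume ab: "a \<in> carrier G" "b \<in> carrier G"
    have "inv (b \<otimes> a \<otimes> inv b) = b \<otimes> inv a \<otimes> inv b" using ab by (simp add: inv_mult_group m_assoc)
    thus "h (inv (b \<otimes> a \<otimes> inv b)) = h (inv a)" using ab hcl by simp
  next
    fix \<chi> assume \<chi>: "\<chi> \<in> Irr G"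
    have "(\<Sum>g\<in>carrier G. h (inv g) * \<chi> g) = (\<Sum>g\<in>carrier G. h (inv g) * cnj (\<chi> (inv g)))"
      using \<chi> by (intro sum.cong) (auto simp: Irr_inv)
    also have "\<dots> = inner h \<chi>" unfolding inner_def by (rule sum_inv[of "\<lambda>g. h g * cnj (\<chi> g)"])
    also have "\<dots> = 0" using projection_residual(1)[OF finite_Irr order_refl \<chi>, of f] by (simp add: h_def)
    finally show "(\<Sum>g\<in>carrier G. h (inv g) * \<chi> g) = 0" .
  qed (rule g)
  hence h0: "h g = 0" if "g \<in> carrier G" for g using that by (metis inv_closed inv_inv)
  have c: "inner f \<chi> = of_nat (card C) * cnj (\<chi> x)" if "\<chi> \<in> Irr G" for \<chi>
  proof -
    have "inner f \<chi> = (\<Sum>g\<in>carrier G. if g \<in> C then cnj (\<chi> g) else 0)"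
      unfolding inner_def f_def by (intro sum.cong) auto
    also have "\<dots> = (\<Sum>g\<in>C. cnj (\<chi> g))" using CG fin by (simp add: sum.If_cases Int_absorb1)
    also have "\<dots> = (\<Sum>g\<in>C. cnj (\<chi> x))"
      by (intro sum.cong) (auto simp: Irr_conj_class[OF that x] C_def)
    finally show ?thesis by simp
  qed
  have "inner h h = 0" by (simp add: inner_def h0)
  hence "inner f f = (\<Sum>\<chi>\<in>Irr G. inner f \<chi> * cnj (inner f \<chi>)) / of_nat N"
    using projection_residual(2)[OF finite_Irr order_refl, of f] by (simp add: h_def N_def)
  also have "inner f f = of_nat (card C)"
  proof -
    have "inner f f = (\<Sum>g\<in>carrier G. if g \<in> C then 1 else 0)"
      unfolding inner_def f_def by (intro sum.cong) auto
    thus ?thesis using CG fin by (simp add: sum.If_cases Int_absorb1)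
  qed
  also have "(\<Sum>\<chi>\<in>Irr G. inner f \<chi> * cnj (inner f \<chi>)) =
      of_real (\<Sum>\<chi>\<in>Irr G. (real (card C))\<^sup>2 * (norm (\<chi> x))\<^sup>2)"
    unfolding of_real_sum
  proof (rule sum.cong[OF refl])
    fix \<chi> assume "\<chi> \<in> Irr G"
    have "complex_of_real ((real (card C))\<^sup>2 * (norm (\<chi> x))\<^sup>2) = (of_nat (card C))\<^sup>2 * (\<chi> x * cnj (\<chi> x))"
      by (simp flip: complex_norm_square)
    moreover have "inner f \<chi> * cnj (inner f \<chi>) = (of_nat (card C))\<^sup>2 * (\<chi> x * cnj (\<chi> x))"
      using \<open>\<chi> \<in> Irr G\<close> by (simp add: c power2_eq_square mult_ac)
    ultimately show "inner f \<chi> * cnj (inner f \<chi>) = complex_of_real ((real (card C))\<^sup>2 * (norm (\<chi> x))\<^sup>2)"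
      by (simp only:)
  qed
  finally have "complex_of_real (real (card C) * real N) =
      of_real (\<Sum>\<chi>\<in>Irr G. (real (card C))\<^sup>2 * (norm (\<chi> x))\<^sup>2)"
    using N by (simp add: field_simps)
  hence "real (card C) * real N = (\<Sum>\<chi>\<in>Irr G. (real (card C))\<^sup>2 * (norm (\<chi> x))\<^sup>2)"
    by (simp only: of_real_eq_iff)
  also have "\<dots> = real (card C) * (\<Sum>\<chi>\<in>Irr G. \<Sum>g\<in>C. (norm (\<chi> g))\<^sup>2)"
  proof -
    have "(real (card C))\<^sup>2 * (norm (\<chi> x))\<^sup>2 = real (card C) * (\<Sum>g\<in>C. (norm (\<chi> g))\<^sup>2)"
      if \<chi>: "\<chi> \<in> Irr G" for \<chi>
    proof -
      have "(\<Sum>g\<in>C. (norm (\<chi> g))\<^sup>2) = (\<Sum>g\<in>C. (norm (\<chi> x))\<^sup>2)"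
        by (intro sum.cong) (auto simp: Irr_conj_class[OF \<chi> x] C_def)
      thus ?thesis by (simp add: power2_eq_square)
    qed
    thus ?thesis unfolding sum_distrib_left[of _ _ "Irr G"] by (intro sum.cong) auto
  qed
  finally show ?thesis using C0 by (simp add: N_def C_def)
qed

text \<open>Double count of the squared absolute values of all irreducible characters at all group
  elements: each class and each character contributes \<open>card (carrier G)\<close>.\<close>

theorem card_Irr: "card (Irr G) = card (conjugacy_classes G)"
proof -
  define N where "N = card (carrier G)"
  have N: "N > 0" using fin by (auto simp: N_def card_gt_0_iff)
  have fC: "finite C" if "C \<in> conjugacy_classes G" for C
    using that Union_classes fin by (metis Sup_upper finite_subset)
  have "real N * card (conjugacy_classes G) =
      (\<Sum>C\<in>conjugacy_classes G. \<Sum>\<chi>\<in>Irr G. \<Sum>g\<in>C. (norm (\<chi> g))\<^sup>2)"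
  proof -
    have "(\<Sum>C\<in>conjugacy_classes G. \<Sum>\<chi>\<in>Irr G. \<Sum>g\<in>C. (norm (\<chi> g))\<^sup>2) =
        (\<Sum>C\<in>conjugacy_classes G. real N)"
      using column_norm by (intro sum.cong) (auto simp: conjugacy_classes_eq N_def)
    thus ?thesis by simp
  qed
  also have "\<dots> = (\<Sum>\<chi>\<in>Irr G. \<Sum>C\<in>conjugacy_classes G. \<Sum>g\<in>C. (norm (\<chi> g))\<^sup>2)"
    by (rule sum.swap)
  also have "\<dots> = (\<Sum>\<chi>\<in>Irr G. \<Sum>g\<in>carrier G. (norm (\<chi> g))\<^sup>2)"
  proof (rule sum.cong[OF refl])
    fix \<chi> assume "\<chi> \<in> Irr G"
    show "(\<Sum>C\<in>conjugacy_classes G. \<Sum>g\<in>C. (norm (\<chi> g))\<^sup>2) = (\<Sum>g\<in>carrier G. (norm (\<chi> g))\<^sup>2)"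
      unfolding Union_classes[symmetric]
      by (subst sum.Union_disjoint) (use fC classes_disjoint in \<open>auto simp: Union_classes\<close>)
  qed
  also have "\<dots> = (\<Sum>\<chi>\<in>Irr G. real N)"
  proof (rule sum.cong[OF refl])
    fix \<chi> assume "\<chi> \<in> Irr G"
    hence "complex_of_real (\<Sum>g\<in>carrier G. (norm (\<chi> g))\<^sup>2) = of_real (real N)"
      using inner_Irr[of \<chi> \<chi>] unfolding inner_self by (simp add: N_def)
    thus "(\<Sum>g\<in>carrier G. (norm (\<chi> g))\<^sup>2) = real N" by (simp only: of_real_eq_iff)
  qed
  finally show ?thesis using N by simp
qed

section \<open>Linear characters\<close>

lemma linear_chars_mult:
  assumes "\<chi> \<in> linear_chars G" "g \<in> carrier G" "h \<in> carrier G"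
  shows "\<chi> (g \<otimes> h) = \<chi> g * \<chi> h"
proof -
  have "\<chi> \<in> Irr G" using assms by (simp add: linear_chars_def)
  then obtain n \<rho> where \<rho>: "irreducible_representation G n \<rho>"
    and \<chi>: "\<And>g. g \<in> carrier G \<Longrightarrow> \<chi> g = mat_trace (\<rho> g)" using IrrE by metis
  note rr = irr_rep[OF \<rho>]
  have "n = 1" using assms(1) \<chi>[of \<one>] rep_one[OF rr] by (auto simp: linear_chars_def mat_trace_one)
  have tr: "\<chi> g = \<rho> g $$ (0,0)" if "g \<in> carrier G" for g
    using rep_carrier[OF rr that] \<chi>[OF that] \<open>n = 1\<close> by (simp add: mat_trace_sum)
  show ?thesis using rep_mult_index[OF rr assms(2,3), of 0 0] \<open>n = 1\<close> assms(2,3) by (simp add: tr)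
qed

text \<open>A multiplicative function is a representation by 1 by 1 matrices, and a one-dimensional
  space has no proper nonzero subspace. Extensionality matches the restriction to the carrier in
  \<open>character\<close>.\<close>

lemma linear_charsI:
  assumes ext: "\<chi> \<in> extensional (carrier G)" and one: "\<chi> \<one> = 1"
    and mult: "\<And>g h. g \<in> carrier G \<Longrightarrow> h \<in> carrier G \<Longrightarrow> \<chi> (g \<otimes> h) = \<chi> g * \<chi> h"
  shows "\<chi> \<in> linear_chars G"
proof -
  define \<rho> where "\<rho> = (\<lambda>g. mat 1 1 (\<lambda>_. \<chi> g))"
  have rep: "representation G 1 \<rho>"
    by (rule representationI) (auto simp: \<rho>_def one mult scalar_prod_def intro!: eq_matI)
  have "irreducible_representation G 1 \<rho>"
    unfolding irreducible_representation_def subspace_vec_iff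
  proof (intro conjI rep allI impI)
    fix W assume W: "(W \<subseteq> carrier_vec 1 \<and> 0\<^sub>v 1 \<in> W \<and> (\<forall>v\<in>W. \<forall>w\<in>W. v + w \<in> W) \<and>
      (\<forall>c. \<forall>v\<in>W. c \<cdot>\<^sub>v v \<in> W)) \<and> (\<forall>g\<in>carrier G. \<forall>w\<in>W. \<rho> g *\<^sub>v w \<in> W)"
    show "W = {0\<^sub>v 1} \<or> W = carrier_vec 1"
    proof (cases "W = {0\<^sub>v 1}")
      case False
      then obtain w where w: "w \<in> W" "w \<noteq> 0\<^sub>v 1" using W by blast
      hence wc: "w \<in> carrier_vec 1" using W by blast
      have "w $ 0 \<noteq> 0"
      proof
        assume "w $ 0 = 0"
        hence "w = 0\<^sub>v 1" using wc by (intro eq_vecI) auto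
        thus False using w by simp
      qed
      have "v \<in> W" if v: "v \<in> carrier_vec 1" for v
      proof -
        have "v = (v $ 0 / w $ 0) \<cdot>\<^sub>v w" using v wc \<open>w $ 0 \<noteq> 0\<close> by (intro eq_vecI) auto
        thus ?thesis using W w by metis
      qed
      thus ?thesis using W by blast
    qed simp
  qed simp
  from Irr_I[OF this] have "character G \<rho> \<in> Irr G" .
  moreover have "character G \<rho> = \<chi>"
    using ext by (auto simp: character_def \<rho>_def mat_trace_sum fun_eq_iff extensional_def)
  ultimately show ?thesis using one by (simp add: linear_chars_def)
qed

text \<open>Scaling each matrix by the nonzero number \<open>\<theta> g\<close> does not change the
  invariant subspaces.\<close>

lemma linear_mult_Irr:
  assumes "\<theta> \<in> linear_chars G" "\<chi> \<in> Irr G"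
  shows "(\<lambda>g\<in>carrier G. \<theta> g * \<chi> g) \<in> Irr G"
proof -
  obtain n \<rho> where \<rho>: "irreducible_representation G n \<rho>"
    and \<chi>: "\<And>g. g \<in> carrier G \<Longrightarrow> \<chi> g = mat_trace (\<rho> g)" using IrrE[OF assms(2)] by metis
  note rr = irr_rep[OF \<rho>]
  note rc = rep_carrier[OF rr]
  define \<sigma> where "\<sigma> = (\<lambda>g. \<theta> g \<cdot>\<^sub>m \<rho> g)"
  have one: "\<theta> \<one> = 1" using assms by (simp add: linear_chars_def)
  have nz: "\<theta> g \<noteq> 0" if "g \<in> carrier G" for g
    using linear_chars_mult[OF assms(1) that, of "inv g"] that one by auto
  have rep: "representation G n \<sigma>"
  proof (rule representationI)
    fix g h assume gh: "g \<in> carrier G" "h \<in> carrier G"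
    have "\<sigma> g * \<sigma> h = \<theta> h \<cdot>\<^sub>m (\<theta> g \<cdot>\<^sub>m (\<rho> g * \<rho> h))"
      using rc[OF gh(1)] rc[OF gh(2)]
      by (simp add: \<sigma>_def mult_smult_distrib[of _ n n _ n] mult_smult_assoc_mat[of _ n n _ n])
    also have "\<dots> = \<sigma> (g \<otimes> h)"
      using rc[OF gh(1)] rc[OF gh(2)] gh
      by (intro eq_matI) (auto simp: \<sigma>_def linear_chars_mult[OF assms(1)] rep_mult[OF rr])
    finally show "\<sigma> (g \<otimes> h) = \<sigma> g * \<sigma> h" ..
  qed (use rc in \<open>auto simp: \<sigma>_def one rep_one[OF rr]\<close>)
  have "irreducible_representation G n \<sigma>"
    unfolding irreducible_representation_def subspace_vec_iff
  proof (intro conjI rep allI impI irr_pos[OF \<rho>])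
    fix W assume W: "(W \<subseteq> carrier_vec n \<and> 0\<^sub>v n \<in> W \<and> (\<forall>v\<in>W. \<forall>w\<in>W. v + w \<in> W) \<and>
      (\<forall>c. \<forall>v\<in>W. c \<cdot>\<^sub>v v \<in> W)) \<and> (\<forall>g\<in>carrier G. \<forall>w\<in>W. \<sigma> g *\<^sub>v w \<in> W)"
    show "W = {0\<^sub>v n} \<or> W = carrier_vec n"
    proof (rule irr_subspace[OF \<rho>])
      fix g v assume g: "g \<in> carrier G" and v: "v \<in> W"
      have vc: "v \<in> carrier_vec n" using v W by blast
      have "\<rho> g *\<^sub>v v = inverse (\<theta> g) \<cdot>\<^sub>v (\<sigma> g *\<^sub>v v)"
        using rc[OF g] vc nz[OF g] by (intro eq_vecI) (auto simp: \<sigma>_def)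
      thus "\<rho> g *\<^sub>v v \<in> W" using W g v by metis
    qed (use W in auto)
  qed
  from Irr_I[OF this] have "character G \<sigma> \<in> Irr G" .
  moreover have "character G \<sigma> = (\<lambda>g\<in>carrier G. \<theta> g * \<chi> g)"
    using \<chi> mat_trace_smult[OF rc] by (auto simp: character_def \<sigma>_def)
  ultimately show ?thesis by simp
qed

end

section \<open>Counting zeros\<close>

lemma card_image_le_if_factors:
  assumes "finite X" "\<And>x y. x \<in> X \<Longrightarrow> y \<in> X \<Longrightarrow> g x = g y \<Longrightarrow> f x = f y"
  shows "card (f ` X) \<le> card (g ` X)"
proof -
  define k where "k = (\<lambda>c. f (SOME x. x \<in> X \<and> g x = c))"
  have "k (g x) = f x" if "x \<in> X" for x
  proof -
    have "(SOME y. y \<in> X \<and> g y = g x) \<in> X \<and> g (SOME y. y \<in> X \<and> g y = g x) = g x"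
      by (rule someI[of "\<lambda>y. y \<in> X \<and> g y = g x" x]) (simp add: that)
    thus ?thesis using assms(2) that unfolding k_def by blast
  qed
  hence "f ` X = k ` (g ` X)" by (auto simp: image_image intro!: image_cong)
  thus ?thesis using assms(1) by (simp add: card_image_le)
qed

lemma card_le_mult_card_image:
  assumes "finite X" "\<And>y. y \<in> f ` X \<Longrightarrow> card {x \<in> X. f x = y} \<le> d"
  shows "card X \<le> card (f ` X) * d"
proof -
  have "card X = card (\<Union>y\<in>f ` X. {x \<in> X. f x = y})" by (rule arg_cong[of _ _ card]) auto
  also have "\<dots> \<le> (\<Sum>y\<in>f ` X. card {x \<in> X. f x = y})" using assms(1) by (intro card_UN_le) auto
  also have "\<dots> \<le> (\<Sum>y\<in>f ` X. d)" using assms(2) by (rule sum_mono)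
  finally show ?thesis by simp
qed

definition zero_count :: "('a, 'b) monoid_scheme \<Rightarrow> ('a \<Rightarrow> complex) \<Rightarrow> nat" where
  "zero_count G \<chi> = card {C \<in> conjugacy_classes G. \<forall>g\<in>C. \<chi> g = 0}"

context fin_group
begin

lemma nz_eq_sum: "nz G = (\<Sum>\<chi>\<in>Irr G. zero_count G \<chi>)"
proof -
  have "{(\<chi>, C). \<chi> \<in> Irr G \<and> C \<in> conjugacy_classes G \<and> (\<forall>g\<in>C. \<chi> g = 0)} =
     Sigma (Irr G) (\<lambda>\<chi>. {C \<in> conjugacy_classes G. \<forall>g\<in>C. \<chi> g = 0})" by auto
  thus ?thesis using finite_Irr finite_classes by (simp add: nz_def zero_count_def card_SigmaI)
qed

lemma linear_nonzero:
  assumes "\<theta> \<in> linear_chars G" "g \<in> carrier G"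
  shows "\<theta> g \<noteq> 0"
proof -
  have "\<theta> g * \<theta> (inv g) = 1"
    using linear_chars_mult[OF assms, of "inv g"] assms by (simp add: linear_chars_def)
  thus ?thesis by auto
qed

lemma linear_inv:
  assumes "\<theta> \<in> linear_chars G" "g \<in> carrier G"
  shows "\<theta> (inv g) = inverse (\<theta> g)"
proof -
  have "\<theta> g * \<theta> (inv g) = 1"
    using linear_chars_mult[OF assms, of "inv g"] assms by (simp add: linear_chars_def)
  thus ?thesis by (metis inverse_unique)
qed

lemma linear_pow:
  assumes "\<theta> \<in> linear_chars G" "g \<in> carrier G"
  shows "\<theta> (g [^] (k::nat)) = \<theta> g ^ k"
  using assms by (induction k) (auto simp: linear_chars_mult, simp add: linear_chars_def)

lemma linear_quotient:
  assumes "\<theta> \<in> linear_chars G" "\<eta> \<in> linear_chars G"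
  shows "(\<lambda>g\<in>carrier G. \<theta> g * inverse (\<eta> g)) \<in> linear_chars G"
  using assms by (intro linear_charsI) (auto simp: linear_chars_mult, auto simp: linear_chars_def)

lemma linear_trivial: "(\<lambda>g\<in>carrier G. 1) \<in> linear_chars G"
  by (intro linear_charsI) auto

lemma linear_chars_ext: "\<theta> \<in> linear_chars G \<Longrightarrow> \<theta> \<in> extensional (carrier G)"
  by (auto simp: linear_chars_def Irr_extensional)

lemma finite_linear: "finite (linear_chars G)"
  using finite_Irr by (simp add: linear_chars_def)

lemma zero_count_linear: "\<theta> \<in> linear_chars G \<Longrightarrow> zero_count G \<theta> = 0"
  unfolding zero_count_def conjugacy_classes_eq using linear_nonzero conj_class_self finite_classes
  by (subst card_eq_0_iff) (auto simp: conjugacy_classes_eq)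

text \<open>Bessel's inequality for the indicator function of \<open>K\<close>, whose inner product
  with each member of \<open>S\<close> is \<open>card K\<close>. For a subgroup \<open>K\<close> it
  bounds the number of such characters by the index.\<close>

lemma card_linear_trivial_on:
  assumes S: "S \<subseteq> linear_chars G" and K: "K \<subseteq> carrier G" "K \<noteq> {}"
    and triv: "\<And>\<theta> k. \<theta> \<in> S \<Longrightarrow> k \<in> K \<Longrightarrow> \<theta> k = 1"
  shows "card S * card K \<le> card (carrier G)"
proof -
  define f where "f = (\<lambda>g. if g \<in> K then 1 else 0 :: complex)"
  have fK: "finite K" using K(1) fin finite_subset by blast
  have fS: "finite S" using S finite_linear finite_subset by blast
  have SI: "S \<subseteq> Irr G" using S by (auto simp: linear_chars_def)
  have ipf: "inner f \<theta> = of_nat (card K)" if "\<theta> \<in> S" for \<theta>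
  proof -
    have "inner f \<theta> = (\<Sum>g\<in>carrier G. if g \<in> K then 1 else 0)"
      unfolding inner_def f_def using triv[OF that] by (intro sum.cong) auto
    thus ?thesis using K(1) fin by (simp add: sum.If_cases Int_absorb1)
  qed
  have "(\<Sum>g\<in>carrier G. (norm (f g))\<^sup>2) = (\<Sum>g\<in>carrier G. if g \<in> K then 1 else 0)"
    unfolding f_def by (intro sum.cong) auto
  also have "\<dots> = real (card K)" using K(1) fin by (simp add: sum.If_cases Int_absorb1)
  finally have nf: "(\<Sum>g\<in>carrier G. (norm (f g))\<^sup>2) = real (card K)" .
  have "real (card S) * (real (card K))\<^sup>2 = (\<Sum>\<chi>\<in>S. (norm (inner f \<chi>))\<^sup>2)" by (simp add: ipf)
  also have "\<dots> \<le> real (card (carrier G)) * real (card K)"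
    using bessel[OF fS SI, of f] by (simp only: nf)
  finally have "real (card S) * real (card K) * real (card K) \<le> real (card (carrier G)) * real (card K)"
    by (simp add: power2_eq_square mult.assoc)
  moreover have "real (card K) > 0" using fK K(2) by (simp add: card_gt_0_iff)
  ultimately have "real (card S) * real (card K) \<le> real (card (carrier G))"
    by (simp add: mult_le_cancel_right)
  thus ?thesis by (metis of_nat_le_iff of_nat_mult)
qed

section \<open>The commutator subgroup and conjugacy classes\<close>

definition commutator_subgroup where "commutator_subgroup = derived G (carrier G)"

lemma commutator_subgroup_normal: "commutator_subgroup \<lhd> G" unfolding commutator_subgroup_def by (rule derived_self_is_normal)

lemma commutator_subgroup_is_subgroup: "subgroup commutator_subgroup G" using commutator_subgroup_normal by (rule normal_imp_subgroup)

lemma linear_trivial_on_commutator_subgroup: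
  assumes "\<theta> \<in> linear_chars G" "d \<in> commutator_subgroup"
  shows "\<theta> d = 1"
proof -
  have one: "\<theta> \<one> = 1" using assms by (simp add: linear_chars_def)
  have K: "subgroup {g \<in> carrier G. \<theta> g = 1} G"
    using assms(1) one by (intro subgroup.intro) (auto simp: linear_chars_mult linear_inv)
  have "commutator_subgroup \<subseteq> {g \<in> carrier G. \<theta> g = 1}"
    unfolding commutator_subgroup_def derived_def
    using assms(1) linear_nonzero[OF assms(1)]
    by (intro generate_subgroup_incl[OF _ K]) (auto simp: linear_chars_mult linear_inv field_simps)
  thus ?thesis using assms(2) by auto
qed

text \<open>Conjugation changes \<open>x\<close> by the commutator
  \<open>g \<otimes> x \<otimes> inv g \<otimes> inv x\<close>.\<close>

lemma conj_class_coset: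
  assumes x: "x \<in> carrier G" and y: "y \<in> conj_class G x"
  shows "commutator_subgroup #> y = commutator_subgroup #> x"
proof -
  obtain g where g: "g \<in> carrier G" "y = g \<otimes> x \<otimes> inv g" using y by (auto simp: conj_class_def)
  have "g \<otimes> x \<otimes> inv g \<otimes> inv x \<in> commutator_subgroup"
    unfolding commutator_subgroup_def derived_def by (rule generate.incl) (use g x in auto)
  hence "y \<otimes> inv x \<in> commutator_subgroup" using g by simp
  moreover have "y \<in> carrier G" using g x by simp
  ultimately have "y \<in> commutator_subgroup #> x" using x commutator_subgroup_is_subgroup by (meson subgroup.rcos_module is_group)
  thus ?thesis using repr_independence[OF _ x commutator_subgroup_is_subgroup] by metis
qed

lemma conj_class_subset_commutator_subgroup:
  assumes "x \<in> commutator_subgroup"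
  shows "conj_class G x \<subseteq> commutator_subgroup"
proof -
  have "g \<otimes> x \<otimes> inv g \<in> commutator_subgroup" if "g \<in> carrier G" for g
    using normal.inv_op_closed2[OF commutator_subgroup_normal that assms] .
  thus ?thesis by (auto simp: conj_class_def)
qed

text \<open>Since a class lies in a single coset of the commutator subgroup, \<open>X\<close> meets
  at least as many classes as cosets, and each coset holds only
  \<open>card commutator_subgroup\<close> elements.\<close>

lemma card_classes_ge:
  assumes X: "X \<subseteq> carrier G"
  shows "card X \<le> card (conj_class G ` X) * card commutator_subgroup"
proof -
  have fX: "finite X" using X fin finite_subset by blast
  have fD: "finite commutator_subgroup" using commutator_subgroup_is_subgroup fin by (meson finite_subset subgroup.subset)
  have "card X \<le> card ((\<lambda>x. commutator_subgroup #> x) ` X) * card commutator_subgroup"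
  proof (rule card_le_mult_card_image[OF fX])
    fix c assume "c \<in> (\<lambda>x. commutator_subgroup #> x) ` X"
    then obtain x where x: "x \<in> X" "c = commutator_subgroup #> x" by blast
    have "{y \<in> X. commutator_subgroup #> y = c} \<subseteq> commutator_subgroup #> x"
    proof
      fix y assume y: "y \<in> {y \<in> X. commutator_subgroup #> y = c}"
      hence "y \<in> commutator_subgroup #> y" using X by (intro rcos_self[OF _ commutator_subgroup_is_subgroup]) auto
      thus "y \<in> commutator_subgroup #> x" using y x by simp
    qed
    moreover have "card (commutator_subgroup #> x) = card commutator_subgroup"
      using x X subgroup.subset[OF commutator_subgroup_is_subgroup] by (intro card_rcosets_equal[symmetric] rcosetsI) auto
    moreover have "finite (commutator_subgroup #> x)"
      using x X by (intro finite_subset[OF r_coset_subset_G fin] subgroup.subset[OF commutator_subgroup_is_subgroup]) auto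
    ultimately show "card {y \<in> X. commutator_subgroup #> y = c} \<le> card commutator_subgroup" by (metis card_mono)
  qed
  also have "card ((\<lambda>x. commutator_subgroup #> x) ` X) \<le> card (conj_class G ` X)"
  proof (rule card_image_le_if_factors[OF fX])
    fix x y assume "x \<in> X" "y \<in> X" "conj_class G x = conj_class G y"
    thus "commutator_subgroup #> x = commutator_subgroup #> y" using X conj_class_coset[of y x] conj_class_self[of x] by auto
  qed
  finally show ?thesis by simp
qed

lemma card_conj_class_dvd: 
  assumes "x \<in> carrier G"
  shows "card (conj_class G x) dvd Coset.order G"
proof -
  have orb: "orbit G (\<lambda>g. \<lambda>h\<in>carrier G. g \<otimes> h \<otimes> inv g) x = conj_class G x"
    unfolding orbit_def conj_class_def restrict_apply'[OF assms] ..
  show ?thesis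
    by (rule dvdI[OF group_action.orbit_stabilizer_theorem[OF action_by_conjugation assms, symmetric, unfolded orb]])
qed

end

section \<open>Groups of odd order\<close>

locale odd_group = fin_group +
  assumes odd: "odd (Coset.order G)"
begin

lemma odd_root_one:
  fixes z :: complex
  assumes "z ^ 2 = 1" "z ^ Coset.order G = 1"
  shows "z = 1"
proof -
  obtain k where "Coset.order G = 2 * k + 1" using odd by (auto elim: oddE)
  hence "z ^ Coset.order G = (z ^ 2) ^ k * z" by (simp add: power_mult)
  thus ?thesis using assms by simp
qed

text \<open>If \<open>x\<close> conjugates \<open>g\<close> to its inverse, then
  \<open>x \<otimes> x\<close> centralises \<open>g\<close>. In odd order \<open>x\<close> is a
  power of its square, so \<open>x\<close> centralises \<open>g\<close> too and \<open>g\<close>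
  equals its inverse.\<close>

lemma real_class_trivial:
  assumes g: "g \<in> carrier G" and c: "inv g \<in> conj_class G g"
  shows "g = \<one>"
proof -
  \<comment> \<open>The exponent \<open>k\<close> inverts squaring:
    \<open>(y \<otimes> y) [^] k = y\<close> for every \<open>y\<close>.\<close>
  have "even (Coset.order G + 1)" using odd by simp
  then obtain k where k: "Coset.order G + 1 = 2 * k" by (rule evenE)
  have root: "y = (y \<otimes> y) [^] k" if y: "y \<in> carrier G" for y
  proof -
    have "y = y [^] (Coset.order G + 1)" using y by (simp add: pow_order_1 flip: nat_pow_mult)
    also have "\<dots> = (y [^] (2::nat)) [^] k" using y by (simp only: k nat_pow_pow)
    also have "y [^] (2::nat) = y \<otimes> y" using y by (simp add: numeral_2_eq_2)
    finally show ?thesis .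
  qed
  obtain x where x: "x \<in> carrier G" "inv g = x \<otimes> g \<otimes> inv x" using c by (auto simp: conj_class_def)
  hence xg: "x \<otimes> g = inv g \<otimes> x" using g by (simp add: m_assoc)
  have "g \<otimes> (x \<otimes> x) = g \<otimes> x \<otimes> (g \<otimes> inv g) \<otimes> x" using g x(1) by (simp add: m_assoc)
  also have "\<dots> = g \<otimes> (x \<otimes> g) \<otimes> (inv g \<otimes> x)" using g x(1) by (simp add: m_assoc del: r_inv Units_r_inv)
  also have "\<dots> = g \<otimes> (inv g \<otimes> x) \<otimes> (x \<otimes> g)" by (simp only: xg)
  also have "\<dots> = (g \<otimes> inv g) \<otimes> (x \<otimes> x) \<otimes> g" using g x(1) by (simp add: m_assoc del: r_inv Units_r_inv)
  finally have "(x \<otimes> x) \<otimes> g = g \<otimes> (x \<otimes> x)" using g x(1) by simp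
  hence "(x \<otimes> x) [^] k \<otimes> g = g \<otimes> (x \<otimes> x) [^] k"
    using g x(1) by (intro group_commutes_pow) auto
  hence "x \<otimes> g = g \<otimes> x" using root[OF x(1)] by simp
  hence "inv g \<otimes> x = g \<otimes> x" using xg by simp
  hence "inv g = g" using g x(1) by simp
  hence "g \<otimes> g = \<one>" using g by (metis l_inv)
  thus ?thesis using root[OF g] by simp
qed

lemma zero_count_ge_2:
  assumes \<chi>: "\<chi> \<in> Irr G" and nl: "\<chi> \<notin> linear_chars G"
  shows "zero_count G \<chi> \<ge> 2"
proof -
  obtain g where g: "g \<in> carrier G" "\<chi> g = 0" using nonlinear_Irr_has_zero[OF assms] by blast
  have "g \<noteq> \<one>" using Irr_one[OF \<chi>] g by auto
  have "conj_class G (inv g) \<noteq> conj_class G g"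
    using real_class_trivial[OF g(1)] conj_class_self[of "inv g"] g \<open>g \<noteq> \<one>\<close> by auto
  hence "2 = card {conj_class G g, conj_class G (inv g)}" by simp
  also have "\<dots> \<le> zero_count G \<chi>"
    unfolding zero_count_def
    using g Irr_conj_class[OF \<chi> g(1)] Irr_conj_class[OF \<chi> inv_closed[OF g(1)]] Irr_inv[OF \<chi> g(1)] finite_classes
    by (intro card_mono) (auto simp: conjugacy_classes_eq)
  finally show ?thesis .
qed

lemma linear_square_trivial:
  assumes "\<theta> \<in> linear_chars G" "\<And>g. g \<in> carrier G \<Longrightarrow> \<theta> g ^ 2 = 1"
  shows "\<theta> = (\<lambda>g\<in>carrier G. 1)"
proof
  fix g
  show "\<theta> g = (\<lambda>g\<in>carrier G. 1) g"
  proof (cases "g \<in> carrier G")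
    case True
    have "\<theta> g ^ Coset.order G = 1"
      using linear_pow[OF assms(1) True, of "Coset.order G"] assms(1) True
      by (simp add: pow_order_1 linear_chars_def)
    thus ?thesis using odd_root_one assms(2) True by simp
  next
    case False
    thus ?thesis using linear_chars_ext[OF assms(1)] by (simp add: extensional_def)
  qed
qed

definition stabiliser where "stabiliser \<chi> = {\<theta> \<in> linear_chars G. \<forall>g\<in>carrier G. \<theta> g * \<chi> g = \<chi> g}"

text \<open>The stabiliser is closed under inverses. A single nontrivial member would be its own
  inverse and have values 1 and -1 only, contrary to odd order.\<close>

lemma card_stabiliser_neq_2: "card (stabiliser \<chi>) \<noteq> 2"
proof
  assume "card (stabiliser \<chi>) = 2"
  let ?t = "\<lambda>g\<in>carrier G. 1 :: complex"
  have t: "?t \<in> stabiliser \<chi>" using linear_trivial by (auto simp: stabiliser_def)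
  from \<open>card (stabiliser \<chi>) = 2\<close> obtain \<theta> where \<theta>: "stabiliser \<chi> = {?t, \<theta>}" "\<theta> \<noteq> ?t"
    using t by (metis card_2_iff doubleton_eq_iff insertE singletonD)
  hence ts: "\<theta> \<in> stabiliser \<chi>" by simp
  hence tl: "\<theta> \<in> linear_chars G" by (simp add: stabiliser_def)
  define \<eta> where "\<eta> = (\<lambda>g\<in>carrier G. ?t g * inverse (\<theta> g))"
  have "\<eta> \<in> linear_chars G" unfolding \<eta>_def by (rule linear_quotient[OF linear_trivial tl])
  moreover have "\<eta> g * \<chi> g = \<chi> g" if g: "g \<in> carrier G" for g
    using ts g linear_nonzero[OF tl g] by (auto simp: \<eta>_def stabiliser_def field_simps)
  ultimately have "\<eta> \<in> stabiliser \<chi>" by (simp add: stabiliser_def)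
  moreover have "\<eta> \<noteq> ?t"
  proof
    assume "\<eta> = ?t"
    have "\<theta> g ^ 2 = 1" if "g \<in> carrier G" for g
      using fun_cong[OF \<open>\<eta> = ?t\<close>, of g] that by (simp add: \<eta>_def)
    thus False using linear_square_trivial[OF tl] \<theta> by blast
  qed
  ultimately have "\<eta> = \<theta>" using \<theta> by blast
  have "\<theta> g ^ 2 = 1" if "g \<in> carrier G" for g
    using fun_cong[OF \<open>\<eta> = \<theta>\<close>, of g] that linear_nonzero[OF tl that] by (simp add: \<eta>_def power2_eq_square field_simps)
  thus False using linear_square_trivial[OF tl] \<theta> by blast
qed

end

section \<open>Consequences of having few zeros on average\<close>

context odd_group
begin

definition nonlinear_chars where "nonlinear_chars = Irr G - linear_chars G"

lemma finite_nonlinear_chars: "finite nonlinear_chars"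
  using finite_Irr by (simp add: nonlinear_chars_def)

lemma card_Irr_split: "card (Irr G) = card (linear_chars G) + card nonlinear_chars"
proof -
  have "linear_chars G \<subseteq> Irr G" by (auto simp: linear_chars_def)
  thus ?thesis using finite_Irr by (simp add: nonlinear_chars_def card_Diff_subset finite_linear card_mono)
qed

text \<open>Linear characters have no zeros and nonlinear ones at least one, so the subtraction of
  naturals is exact and \<open>nz G\<close> splits into the excess and
  \<open>card nonlinear_chars\<close>.\<close>

lemma sum_excess:
  assumes "nz G < card (Irr G)"
  shows "(\<Sum>\<chi>\<in>nonlinear_chars. zero_count G \<chi> - 1) < card (linear_chars G)"
proof -
  have "nz G = (\<Sum>\<chi>\<in>nonlinear_chars. zero_count G \<chi>)"
    unfolding nz_eq_sum nonlinear_chars_def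
    by (rule sum.mono_neutral_right) (auto simp: finite_Irr zero_count_linear)
  also have "\<dots> = (\<Sum>\<chi>\<in>nonlinear_chars. zero_count G \<chi> - 1 + 1)"
  proof (rule sum.cong[OF refl])
    fix \<chi> assume "\<chi> \<in> nonlinear_chars"
    thus "zero_count G \<chi> = zero_count G \<chi> - 1 + 1" using zero_count_ge_2[of \<chi>] by (simp add: nonlinear_chars_def)
  qed
  also have "\<dots> = (\<Sum>\<chi>\<in>nonlinear_chars. zero_count G \<chi> - 1) + card nonlinear_chars"
    by (simp only: sum.distrib) simp
  finally show ?thesis using assms card_Irr_split by simp
qed

text \<open>All members of the orbit of \<open>\<chi>\<close> under multiplication by linear characters have the same zeros.\<close>

lemma zero_count_le_card_stabiliser:
  assumes nz: "nz G < card (Irr G)" and \<chi>: "\<chi> \<in> nonlinear_chars"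
  shows "zero_count G \<chi> \<le> card (stabiliser \<chi>)"
proof -
  define T where "T = (\<lambda>\<theta>. \<lambda>g\<in>carrier G. \<theta> g * \<chi> g)"
  define L where "L = linear_chars G"
  have fL: "finite L" using finite_linear by (simp add: L_def)
  have \<chi>I: "\<chi> \<in> Irr G" using \<chi> by (simp add: nonlinear_chars_def)
  have TI: "T \<theta> \<in> nonlinear_chars" and Tz: "zero_count G (T \<theta>) = zero_count G \<chi>" if \<theta>: "\<theta> \<in> L" for \<theta>
  proof -
    have tl: "\<theta> \<in> linear_chars G" using \<theta> by (simp add: L_def)
    have "T \<theta> \<in> Irr G" using linear_mult_Irr[OF tl \<chi>I] by (simp add: T_def)
    moreover have "T \<theta> \<one> = \<chi> \<one>" using tl by (simp add: T_def linear_chars_def)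
    ultimately show "T \<theta> \<in> nonlinear_chars" using \<chi> by (auto simp: nonlinear_chars_def linear_chars_def)
    have "(\<forall>g\<in>C. T \<theta> g = 0) \<longleftrightarrow> (\<forall>g\<in>C. \<chi> g = 0)" if "C \<in> conjugacy_classes G" for C
    proof -
      have "C \<subseteq> carrier G" using that Union_classes by blast
      hence "T \<theta> g = 0 \<longleftrightarrow> \<chi> g = 0" if "g \<in> C" for g
        using that linear_nonzero[OF tl, of g] by (auto simp: T_def)
      thus ?thesis by blast
    qed
    hence "{C \<in> conjugacy_classes G. \<forall>g\<in>C. T \<theta> g = 0} = {C \<in> conjugacy_classes G. \<forall>g\<in>C. \<chi> g = 0}"
      by blast
    thus "zero_count G (T \<theta>) = zero_count G \<chi>" by (simp add: zero_count_def)
  qed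
  \<comment> \<open>Dividing by one fixed member \<open>\<eta>\<close> maps a fibre of
    \<open>T\<close> injectively into the stabiliser, so the orbit cannot be too short.\<close>
  have "card L \<le> card (T ` L) * card (stabiliser \<chi>)"
  proof (rule card_le_mult_card_image[OF fL])
    fix \<psi> assume "\<psi> \<in> T ` L"
    then obtain \<eta> where \<eta>: "\<eta> \<in> linear_chars G" "\<psi> = T \<eta>" by (auto simp: L_def)
    define q where "q = (\<lambda>\<theta>. \<lambda>g\<in>carrier G. \<theta> g * inverse (\<eta> g))"
    have "inj_on q {\<theta> \<in> L. T \<theta> = \<psi>}"
    proof (rule inj_onI)
      fix a b assume ab: "a \<in> {\<theta> \<in> L. T \<theta> = \<psi>}" "b \<in> {\<theta> \<in> L. T \<theta> = \<psi>}" "q a = q b"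
      have "a g = b g" if "g \<in> carrier G" for g
        using fun_cong[OF ab(3), of g] that linear_nonzero[OF \<eta>(1) that] by (simp add: q_def)
      thus "a = b" using ab linear_chars_ext by (intro extensionalityI[of _ "carrier G"]) (auto simp: L_def)
    qed
    moreover have "q ` {\<theta> \<in> L. T \<theta> = \<psi>} \<subseteq> stabiliser \<chi>"
    proof safe
      fix \<theta> assume \<theta>: "\<theta> \<in> L" "\<psi> = T \<theta>"
      have "q \<theta> \<in> linear_chars G" using \<theta> \<eta>(1) unfolding q_def L_def by (intro linear_quotient)
      moreover have "q \<theta> g * \<chi> g = \<chi> g" if g: "g \<in> carrier G" for g
      proof -
        have "T \<eta> = T \<theta>" using \<eta> \<theta> by simp
        from fun_cong[OF this, of g] have "\<eta> g * \<chi> g = \<theta> g * \<chi> g" using g by (simp add: T_def)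
        thus ?thesis using g linear_nonzero[OF \<eta>(1) g] by (auto simp: q_def field_simps)
      qed
      ultimately show "q \<theta> \<in> stabiliser \<chi>" by (simp add: stabiliser_def)
    qed
    moreover have "finite (stabiliser \<chi>)" using finite_linear by (simp add: stabiliser_def)
    ultimately show "card {\<theta> \<in> L. T \<theta> = \<psi>} \<le> card (stabiliser \<chi>)" by (rule card_inj_on_le)
  qed
  \<comment> \<open>The excess of \<open>\<chi>\<close> is repeated at every member of the orbit,
    and the total is bounded by \<open>sum_excess\<close>.\<close>
  moreover have "card (T ` L) * (zero_count G \<chi> - 1) < card L"
  proof -
    have "card (T ` L) * (zero_count G \<chi> - 1) = (\<Sum>\<psi>\<in>T ` L. zero_count G \<chi> - 1)" by simp
    also have "\<dots> = (\<Sum>\<psi>\<in>T ` L. zero_count G \<psi> - 1)" using Tz by (intro sum.cong) auto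
    also have "\<dots> \<le> (\<Sum>\<psi>\<in>nonlinear_chars. zero_count G \<psi> - 1)" using TI finite_nonlinear_chars by (intro sum_mono2) auto
    also have "\<dots> < card L" using sum_excess[OF nz] by (simp add: L_def)
    finally show ?thesis .
  qed
  ultimately have "card (T ` L) * (zero_count G \<chi> - 1) < card (T ` L) * card (stabiliser \<chi>)" by linarith
  hence "zero_count G \<chi> - 1 < card (stabiliser \<chi>)" by (simp only: mult_less_cancel1)
  thus ?thesis by linarith
qed

text \<open>\<open>\<chi>\<close> vanishes off the common kernel \<open>K\<close> of its stabiliser; counting cosets of the commutator
  subgroup outside \<open>K\<close> against \<open>zero_count_le_card_stabiliser\<close> forces \<open>K\<close> to be the commutator
  subgroup itself.\<close>

lemma zero_count_ge_index:
  assumes nz: "nz G < card (Irr G)" and \<chi>: "\<chi> \<in> nonlinear_chars"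
  shows "card (rcosets commutator_subgroup) - 1 \<le> zero_count G \<chi>" and "card (linear_chars G) \<ge> 3"
proof -
  define K where "K = {g \<in> carrier G. \<forall>\<theta>\<in>stabiliser \<chi>. \<theta> g = 1}"
  define s where "s = card (stabiliser \<chi>)"
  define z where "z = zero_count G \<chi>"
  have sl: "stabiliser \<chi> \<subseteq> linear_chars G" by (auto simp: stabiliser_def)
  have \<chi>I: "\<chi> \<in> Irr G" using \<chi> by (simp add: nonlinear_chars_def)
  have z2: "z \<ge> 2" using zero_count_ge_2 \<chi> by (simp add: nonlinear_chars_def z_def)
  have zs: "z \<le> s" using zero_count_le_card_stabiliser[OF assms] by (simp add: z_def s_def)
  have s3: "s \<ge> 3" using z2 zs card_stabiliser_neq_2[of \<chi>] by (simp add: s_def)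
  have "s \<le> card (linear_chars G)" unfolding s_def by (rule card_mono[OF finite_linear sl])
  thus "card (linear_chars G) \<ge> 3" using s3 by simp
  have K: "subgroup K G"
  proof (rule subgroup.intro)
    show "K \<subseteq> carrier G" by (auto simp: K_def)
    show "x \<otimes> y \<in> K" if "x \<in> K" "y \<in> K" for x y
      using that sl by (auto simp: K_def linear_chars_mult subset_iff)
    show "\<one> \<in> K" using sl by (auto simp: K_def linear_chars_def)
    show "inv x \<in> K" if "x \<in> K" for x using that sl by (auto simp: K_def linear_inv subset_iff)
  qed
  have KG: "K \<subseteq> carrier G" using K by (rule subgroup.subset)
  have K1: "\<one> \<in> K" using K by (rule subgroup.one_closed)
  have DK: "commutator_subgroup \<subseteq> K"
  proof
    fix d assume d: "d \<in> commutator_subgroup"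
    thus "d \<in> K" using linear_trivial_on_commutator_subgroup[OF _ d] sl subgroup.mem_carrier[OF commutator_subgroup_is_subgroup d]
      by (auto simp: K_def)
  qed
  define n where "n = Coset.order G"
  have nc: "n = card (carrier G)" by (simp add: n_def Coset.order_def)
  have n0: "n > 0" using order_pos by (simp add: n_def)
  \<comment> \<open>\<open>b\<close> is the index of \<open>K\<close> in the group, and
    \<open>c\<close> below is the index of the commutator subgroup in \<open>K\<close>.\<close>
  obtain b where b: "n = b * card K" using lagrange[OF K] by (metis n_def)
  have a: "n = card (rcosets commutator_subgroup) * card commutator_subgroup" using lagrange[OF commutator_subgroup_is_subgroup] by (simp add: n_def)
  obtain c where c: "card K = c * card commutator_subgroup"
  proof -
    have "subgroup commutator_subgroup (G\<lparr>carrier := K\<rparr>)" using subgroup_incl[OF commutator_subgroup_is_subgroup K DK] .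
    from group.lagrange[OF subgroup_imp_group[OF K] this]
    have "card (rcosets\<^bsub>G\<lparr>carrier := K\<rparr>\<^esub> commutator_subgroup) * card commutator_subgroup = card K" by (simp add: Coset.order_def)
    thus ?thesis by (rule that[OF sym])
  qed
  \<comment> \<open>The stabiliser consists of linear characters trivial on \<open>K\<close>, so its
    order is at most the index \<open>b\<close>.\<close>
  have "s * card K \<le> b * card K"
  proof -
    have "K \<noteq> {}" using K1 by auto
    hence "card (stabiliser \<chi>) * card K \<le> card (carrier G)"
      by (rule card_linear_trivial_on[OF sl KG]) (simp add: K_def)
    thus ?thesis using b by (simp add: s_def nc)
  qed
  moreover have K0: "card K > 0" using n0 b by (auto intro: Nat.gr0I)
  ultimately have sb: "s \<le> b" by simp
  have d0: "card commutator_subgroup > 0" using n0 a by (auto intro: Nat.gr0I)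
  have c0: "c > 0" using K0 c by (auto intro: Nat.gr0I)
  \<comment> \<open>Every class outside \<open>K\<close> is a zero of \<open>\<chi>\<close>, and
    there are at least \<open>b * c - c\<close> of them because a class lies within one coset of the
    commutator subgroup.\<close>
  have "n - card K \<le> z * card commutator_subgroup"
  proof -
    have "n - card K = card (carrier G - K)"
      using KG fin finite_subset[OF KG fin] by (simp add: nc card_Diff_subset)
    also have "\<dots> \<le> card (conj_class G ` (carrier G - K)) * card commutator_subgroup" by (rule card_classes_ge) auto
    also have "card (conj_class G ` (carrier G - K)) \<le> z"
      unfolding z_def zero_count_def
    proof (rule card_mono)
      show "conj_class G ` (carrier G - K) \<subseteq> {C \<in> conjugacy_classes G. \<forall>g\<in>C. \<chi> g = 0}"
      proof safe
        fix x assume x: "x \<in> carrier G" "x \<notin> K"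
        show "conj_class G x \<in> conjugacy_classes G" using x by (simp add: conjugacy_classes_eq)
        obtain \<theta> where "\<theta> \<in> stabiliser \<chi>" "\<theta> x \<noteq> 1" using x by (auto simp: K_def)
        hence "\<chi> x = 0" using x by (auto simp: stabiliser_def)
        thus "\<chi> g = 0" if "g \<in> conj_class G x" for g using Irr_conj_class[OF \<chi>I x(1) that] by simp
      qed
    qed (use finite_classes in auto)
    finally show ?thesis by simp
  qed
  hence "b * (c * card commutator_subgroup) - c * card commutator_subgroup \<le> z * card commutator_subgroup" using b c by simp
  hence "(b * c - c) * card commutator_subgroup \<le> z * card commutator_subgroup" by (simp add: diff_mult_distrib mult.assoc)
  hence bc: "b * c - c \<le> z" using d0 by simp
  \<comment> \<open>For \<open>c \<ge> 2\<close> the chain 2(b - 1) \<le> z \<le> s \<le> b gives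
    \<open>b \<le> 2\<close>, while \<open>b \<ge> s \<ge> 3\<close>.\<close>
  have "c = 1"
  proof (rule ccontr)
    assume "c \<noteq> 1"
    hence "c \<ge> 2" using c0 by simp
    hence "2 * (b - 1) \<le> (b - 1) * c" by simp
    also have "\<dots> = b * c - c" by (simp add: diff_mult_distrib)
    also have "\<dots> \<le> b" using bc zs sb by simp
    finally show False using sb s3 by simp
  qed
  hence "card (rcosets commutator_subgroup) = b" using a b c d0 by simp
  thus "card (rcosets commutator_subgroup) - 1 \<le> zero_count G \<chi>" using bc \<open>c = 1\<close> by (simp add: z_def)
qed

lemma linear_le_index: "card (linear_chars G) \<le> card (rcosets commutator_subgroup)"
proof -
  have "card (linear_chars G) * card commutator_subgroup \<le> card (carrier G)"
    using linear_trivial_on_commutator_subgroup subgroup.subset[OF commutator_subgroup_is_subgroup] subgroup.one_closed[OF commutator_subgroup_is_subgroup]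
    by (intro card_linear_trivial_on) auto
  also have "\<dots> = card (rcosets commutator_subgroup) * card commutator_subgroup" using lagrange[OF commutator_subgroup_is_subgroup] by (simp add: Coset.order_def)
  moreover have "card commutator_subgroup > 0"
    using order_pos lagrange[OF commutator_subgroup_is_subgroup] by (auto intro: Nat.gr0I)
  ultimately show ?thesis by simp
qed

lemma outer_classes:
  "card (rcosets commutator_subgroup) - 1 \<le> card (conj_class G ` (carrier G - commutator_subgroup))"
proof -
  have DG: "commutator_subgroup \<subseteq> carrier G" by (rule subgroup.subset[OF commutator_subgroup_is_subgroup])
  have e: "card (carrier G) = card (rcosets commutator_subgroup) * card commutator_subgroup" using lagrange[OF commutator_subgroup_is_subgroup] by (simp add: Coset.order_def)
  have d0: "card commutator_subgroup > 0" using order_pos lagrange[OF commutator_subgroup_is_subgroup] by (auto intro: Nat.gr0I)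
  have "(card (rcosets commutator_subgroup) - 1) * card commutator_subgroup = card (carrier G - commutator_subgroup)"
    using DG fin finite_subset[OF DG fin] by (simp add: card_Diff_subset e diff_mult_distrib)
  also have "\<dots> \<le> card (conj_class G ` (carrier G - commutator_subgroup)) * card commutator_subgroup" by (rule card_classes_ge) auto
  finally show ?thesis using d0 by simp
qed

lemma classes_split:
  "card (conjugacy_classes G) = card (conj_class G ` commutator_subgroup) + card (conj_class G ` (carrier G - commutator_subgroup))"
proof -
  have DG: "commutator_subgroup \<subseteq> carrier G" by (rule subgroup.subset[OF commutator_subgroup_is_subgroup])
  have "conjugacy_classes G = conj_class G ` commutator_subgroup \<union> conj_class G ` (carrier G - commutator_subgroup)"
    using DG by (auto simp: conjugacy_classes_eq)
  moreover have "conj_class G ` commutator_subgroup \<inter> conj_class G ` (carrier G - commutator_subgroup) = {}"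
  proof (rule equals0I)
    fix C assume "C \<in> conj_class G ` commutator_subgroup \<inter> conj_class G ` (carrier G - commutator_subgroup)"
    then obtain x y where "x \<in> commutator_subgroup" "C = conj_class G x" "y \<in> carrier G - commutator_subgroup" "C = conj_class G y" by blast
    thus False using conj_class_subset_commutator_subgroup[of x] conj_class_self[of y] by auto
  qed
  moreover have "finite (conj_class G ` commutator_subgroup)" "finite (conj_class G ` (carrier G - commutator_subgroup))"
    using fin finite_subset[OF DG fin] by auto
  ultimately show ?thesis by (simp add: card_Un_disjoint)
qed

lemma conj_class_one: "conj_class G \<one> = {\<one>}"
  by (auto simp: conj_class_def intro!: exI[of _ \<one>])

lemma three_classes:
  assumes x: "x \<in> carrier G" "x \<noteq> \<one>"
  shows "conj_class G x \<noteq> conj_class G (inv x)" "conj_class G x \<noteq> conj_class G \<one>" "conj_class G (inv x) \<noteq> conj_class G \<one>"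
proof -
  show "conj_class G x \<noteq> conj_class G (inv x)"
    using real_class_trivial[OF x(1)] conj_class_self[of "inv x"] x by auto
  show "conj_class G x \<noteq> conj_class G \<one>" using conj_class_self[of x] x by (auto simp: conj_class_one)
  have "inv x \<noteq> \<one>" using x by (simp add: inv_eq_1_iff)
  thus "conj_class G (inv x) \<noteq> conj_class G \<one>" using conj_class_self[OF inv_closed[OF x(1)]] by (auto simp: conj_class_one)
qed

lemma card_conj_class_inv:
  assumes x: "x \<in> carrier G"
  shows "card (conj_class G (inv x)) = card (conj_class G x)"
proof -
  have "conj_class G (inv x) = (\<lambda>g. inv g) ` conj_class G x"
  proof -
    have "inv (g \<otimes> x \<otimes> inv g) = g \<otimes> inv x \<otimes> inv g" if "g \<in> carrier G" for g
      using x that by (simp add: inv_mult_group m_assoc)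
    thus ?thesis unfolding conj_class_def by (auto simp: image_iff) metis+
  qed
  moreover have "inj_on (\<lambda>g. inv g) (conj_class G x)"
    using conj_class_carrier[OF x] by (intro inj_onI) (metis inv_inv subsetD)
  ultimately show ?thesis by (simp add: card_image)
qed

text \<open>The equality of the numbers of characters and classes meets lower bounds on the classes
  inside and outside the commutator subgroup, while the excess of zeros bounds \<open>m\<close> and
  \<open>L\<close> from above. The margins are so narrow that every estimate is attained.\<close>

theorem derived_structure:
  assumes nz: "nz G < card (Irr G)" and D1: "commutator_subgroup \<noteq> {\<one>}"
  shows "card (rcosets commutator_subgroup) = 3" "card commutator_subgroup = 3 \<or> card commutator_subgroup = 7"
proof -
  define a where "a = card (rcosets commutator_subgroup)"
  define L where "L = card (linear_chars G)"
  define m where "m = card nonlinear_chars"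
  have DG: "commutator_subgroup \<subseteq> carrier G" by (rule subgroup.subset[OF commutator_subgroup_is_subgroup])
  have fD: "finite commutator_subgroup" by (rule finite_subset[OF DG fin])
  have one: "\<one> \<in> commutator_subgroup" by (rule subgroup.one_closed[OF commutator_subgroup_is_subgroup])
  obtain x where x: "x \<in> commutator_subgroup" "x \<noteq> \<one>" using D1 one by blast
  have xG: "x \<in> carrier G" using x DG by blast
  have ix: "inv x \<in> commutator_subgroup" using x commutator_subgroup_is_subgroup by (simp add: subgroup.m_inv_closed)
  define A where "A = {conj_class G \<one>, conj_class G x, conj_class G (inv x)}"
  have A3: "card A = 3" using three_classes[OF xG x(2)] by (simp add: A_def)
  have AD: "A \<subseteq> conj_class G ` commutator_subgroup" using one x ix by (auto simp: A_def)
  have E3: "card (conj_class G ` commutator_subgroup) \<ge> 3" using card_mono[OF finite_imageI[OF fD] AD] A3 by simp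
  have tot: "L + m = card (conj_class G ` commutator_subgroup) + card (conj_class G ` (carrier G - commutator_subgroup))"
    using card_Irr_split card_Irr classes_split by (simp add: L_def m_def)
  have La: "L \<le> a" using linear_le_index by (simp add: L_def a_def)
  have out: "a - 1 \<le> card (conj_class G ` (carrier G - commutator_subgroup))" using outer_classes by (simp add: a_def)
  \<comment> \<open>There are at least 3 + (a - 1) classes and at most \<open>a\<close> linear
    characters.\<close>
  have m2: "m \<ge> 2" using tot La out E3 by linarith
  have L3: "L \<ge> 3"
  proof -
    have "nonlinear_chars \<noteq> {}" using m2 by (auto simp: m_def)
    then obtain \<chi> where "\<chi> \<in> nonlinear_chars" by blast
    from zero_count_ge_index(2)[OF nz this] show ?thesis by (simp add: L_def)
  qed
  \<comment> \<open>Each nonlinear character has at least a - 1 \<ge> L - 1 zeros, hence excess at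
    least \<open>L - 2\<close>.\<close>
  have "m * (L - 2) = (\<Sum>\<chi>\<in>nonlinear_chars. L - 2)" by (simp add: m_def)
  also have "\<dots> \<le> (\<Sum>\<chi>\<in>nonlinear_chars. zero_count G \<chi> - 1)"
  proof (rule sum_mono)
    fix \<chi> assume "\<chi> \<in> nonlinear_chars"
    from zero_count_ge_index(1)[OF nz this] show "L - 2 \<le> zero_count G \<chi> - 1"
      using La by (simp add: a_def)
  qed
  also have "\<dots> < L" using sum_excess[OF nz] by (simp add: L_def)
  finally have mL: "m * (L - 2) < L" .
  have "2 * (L - 2) \<le> m * (L - 2)" using m2 by simp
  hence "L = 3" using mL L3 by linarith
  hence "m = 2" using mL m2 by simp
  \<comment> \<open>Of the five classes at least 3 lie inside the commutator subgroup and at least a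
    - 1 \<ge> 2 outside.\<close>
  have a3: "a = 3" and E: "card (conj_class G ` commutator_subgroup) = 3" using tot La out E3 \<open>L = 3\<close> \<open>m = 2\<close> by linarith+
  show "card (rcosets commutator_subgroup) = 3" using a3 by (simp add: a_def)
  have "conj_class G ` commutator_subgroup = A" using card_subset_eq[OF finite_imageI[OF fD] AD] A3 E by simp
  hence "commutator_subgroup = \<Union>A"
  proof -
    have "commutator_subgroup = \<Union>(conj_class G ` commutator_subgroup)" using conj_class_subset_commutator_subgroup conj_class_self DG by blast
    thus ?thesis using \<open>conj_class G ` commutator_subgroup = A\<close> by simp
  qed
  have dis: "C \<inter> C' = {}" if "C \<in> A" "C' \<in> A" "C \<noteq> C'" for C C'
    using that classes_disjoint AD DG by (auto simp: conjugacy_classes_eq A_def xG)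
  define q where "q = card (conj_class G x)"
  have "card commutator_subgroup = (\<Sum>C\<in>A. card C)"
    unfolding \<open>commutator_subgroup = \<Union>A\<close>
  proof (rule card_Union_disjoint)
    show "pairwise disjnt A" using dis by (auto simp: pairwise_def disjnt_def)
    show "finite C" if "C \<in> A" for C
      using that \<open>commutator_subgroup = \<Union>A\<close> fD by (metis Sup_upper finite_subset)
  qed
  also have "\<dots> = card (conj_class G \<one>) + (card (conj_class G x) + card (conj_class G (inv x)))"
    using three_classes[OF xG x(2)] by (simp add: A_def)
  also have "\<dots> = 1 + 2 * q" by (simp add: card_conj_class_inv[OF xG] conj_class_one q_def)
  finally have d: "card commutator_subgroup = 1 + 2 * q" .
  have "q dvd Coset.order G" unfolding q_def by (rule card_conj_class_dvd[OF xG])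
  also have "Coset.order G = 3 * (1 + 2 * q)" using lagrange[OF commutator_subgroup_is_subgroup] a3 d by (simp add: a_def)
  also have "\<dots> = 6 * q + 3" by simp
  finally have "q dvd 3" by (simp add: dvd_add_right_iff)
  moreover have "prime (3::nat)" by simp
  ultimately have "q = 1 \<or> q = 3" by (auto simp: prime_nat_iff)
  thus "card commutator_subgroup = 3 \<or> card commutator_subgroup = 7" using d by auto
qed

end

section \<open>Cyclic factors and normal series\<close>

context group
begin

text \<open>Tests cyclicity of a factor by cosets and powers taken in \<open>G\<close>, which agree
  with those in the restricted group.\<close>

lemma cyclic_factor:
  assumes N: "N \<lhd> G" and H: "subgroup H G" and NH: "N \<subseteq> H" and x: "x \<in> H"
    and gen: "\<And>h. h \<in> H \<Longrightarrow> \<exists>k::int. h \<in> N #> x [^] k"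
  shows "cyclic_group ((G\<lparr>carrier := H\<rparr>) Mod N)"
proof -
  let ?H = "G\<lparr>carrier := H\<rparr>"
  interpret H: group ?H by (rule subgroup_imp_group[OF H])
  have NHn: "N \<lhd> ?H" by (rule normal_restrict_supergroup[OF H N NH])
  interpret F: group "?H Mod N" by (rule normal.factorgroup_is_group[OF NHn])
  have pow: "(N #> x) [^]\<^bsub>?H Mod N\<^esub> k = N #> x [^] k" for k :: int
    using normal.FactGroup_int_pow[OF NHn, of x k] x int_pow_consistent[OF H x, of k] by simp
  have car: "carrier (?H Mod N) = (\<lambda>h. N #> h) ` H" by (simp add: carrier_FactGroup)
  have "N #> h \<in> range (([^]\<^bsub>?H Mod N\<^esub>) (N #> x) :: int \<Rightarrow> _)" if h: "h \<in> H" for h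
  proof -
    obtain k :: int where k: "h \<in> N #> x [^] k" using gen[OF h] by blast
    have "x [^] k \<in> carrier G" using x subgroup.mem_carrier[OF H] by simp
    hence "N #> x [^] k = N #> h"
      by (rule repr_independence[OF k _ normal_imp_subgroup[OF N]])
    thus ?thesis using pow by (metis rangeI)
  qed
  moreover have "(N #> x) [^]\<^bsub>?H Mod N\<^esub> (k::int) \<in> carrier (?H Mod N)" for k
    using x by (intro F.int_pow_closed) (simp add: car)
  ultimately have "carrier (?H Mod N) = range (([^]\<^bsub>?H Mod N\<^esub>) (N #> x) :: int \<Rightarrow> _)"
    unfolding car by (intro equalityI) auto
  moreover have "N #> x \<in> carrier (?H Mod N)" using x by (simp add: car)
  ultimately show ?thesis unfolding F.cyclic_group by blast
qed

text \<open>By Lagrange's theorem the powers of a nontrivial element fill the group.\<close>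

lemma cyclic_if_prime_order:
  assumes "prime (Coset.order G)"
  shows "cyclic_group G"
proof -
  have "Coset.order G > 0" using assms by (rule prime_gt_0_nat)
  hence fin: "finite (carrier G)" by (simp add: order_gt_0_iff_finite)
  have "card (carrier G) \<noteq> 1" using assms by (auto simp: Coset.order_def)
  hence "carrier G \<noteq> {\<one>}" by auto
  then obtain x where x: "x \<in> carrier G" "x \<noteq> \<one>" using one_closed by blast
  define R where "R = range (\<lambda>k::int. x [^] k)"
  have R: "subgroup R G" unfolding R_def by (rule subgroup_of_powers[OF x(1)])
  have RG: "R \<subseteq> carrier G" by (rule subgroup.subset[OF R])
  have fR: "finite R" by (rule finite_subset[OF RG fin])
  have "card R dvd Coset.order G" using lagrange[OF R] by (metis dvd_triv_right)
  hence "card R = 1 \<or> card R = Coset.order G" using assms by (auto simp: prime_nat_iff)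
  moreover have "card R \<noteq> 1"
  proof
    assume "card R = 1"
    moreover have "x \<in> R" using x by (auto simp: R_def intro!: image_eqI[of _ _ 1])
    moreover have "\<one> \<in> R" by (rule subgroup.one_closed[OF R])
    ultimately show False using x(2) by (metis card_1_singletonE singletonD)
  qed
  ultimately have "R = carrier G" using card_subset_eq[OF fin RG] by (simp add: Coset.order_def)
  thus ?thesis unfolding cyclic_group using x by (auto simp: R_def)
qed

text \<open>The terms are generated by growing initial segments of a list of all elements: one new
  generator per step makes the factor cyclic, and commutativity makes every term normal. Repetitions
  in the list only give trivial factors.\<close>

lemma supersolvable_if_comm:
  assumes comm: "comm_group G" and fin: "finite (carrier G)"
  shows "supersolvable G"
proof -
  interpret comm_group G by (rule comm)
  obtain xs where xs: "set xs = carrier G" using finite_list[OF fin] by blast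
  define N where "N = (\<lambda>i. generate G (set (take i xs)))"
  have tG: "set (take i xs) \<subseteq> carrier G" for i using set_take_subset[of i xs] xs by simp
  have sub: "subgroup (N i) G" for i unfolding N_def by (rule generate_is_subgroup[OF tG])
  have mono: "N i \<subseteq> N (Suc i)" for i
    unfolding N_def by (intro mono_generate set_take_subset_set_take) simp
  have "cyclic_group ((G\<lparr>carrier := N (Suc i)\<rparr>) Mod N i)" if i: "i < length xs" for i
  proof (rule cyclic_factor[OF subgroup_imp_normal[OF sub] sub mono])
    have xi: "xs ! i \<in> carrier G" using i xs nth_mem by blast
    have tk: "set (take (Suc i) xs) = insert (xs ! i) (set (take i xs))"
      using i by (simp add: take_Suc_conv_app_nth)
    show "xs ! i \<in> N (Suc i)" unfolding N_def tk by (rule generate.incl) simp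
    define R where "R = range (\<lambda>k::int. (xs ! i) [^] k)"
    have R: "subgroup R G" unfolding R_def by (rule subgroup_of_powers[OF xi])
    \<comment> \<open>This product is a subgroup containing all generators of the next term, so
      every element of that term is a power of the new generator up to a factor in
      \<open>N i\<close>.\<close>
    have NR: "subgroup (N i <#> R) G" by (rule mult_subgroups[OF sub R])
    have "set (take (Suc i) xs) \<subseteq> N i <#> R"
    proof
      fix y assume "y \<in> set (take (Suc i) xs)"
      then consider "y = xs ! i" | "y \<in> set (take i xs)" using tk by blast
      thus "y \<in> N i <#> R"
      proof cases
        case 1
        have "xs ! i \<in> R" using xi by (auto simp: R_def intro!: image_eqI[of _ _ 1])
        hence "\<one> \<otimes> xs ! i \<in> N i <#> R"
          using subgroup.one_closed[OF sub] unfolding set_mult_def by blast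
        thus ?thesis using 1 xi by simp
      next
        case 2
        hence "y \<in> N i" unfolding N_def by (rule generate.incl)
        hence "y \<otimes> \<one> \<in> N i <#> R"
          using subgroup.one_closed[OF R] unfolding set_mult_def by blast
        thus ?thesis using 2 tG[of i] by auto
      qed
    qed
    hence "generate G (set (take (Suc i) xs)) \<subseteq> N i <#> R" by (rule generate_subgroup_incl[OF _ NR])
    hence "N (Suc i) \<subseteq> N i <#> R" by (simp only: N_def)
    thus "\<exists>k::int. h \<in> N i #> (xs ! i) [^] k" if "h \<in> N (Suc i)" for h
      using that by (fastforce simp: set_mult_def r_coset_def R_def)
  qed
  moreover have "N 0 = {\<one>}" by (simp add: N_def generate_empty)
  moreover have "N (length xs) = carrier G"
    using generate_incl[of "carrier G"] generate.incl[of _ "carrier G" G] by (auto simp: N_def xs)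
  ultimately show ?thesis
    unfolding supersolvable_def using mono subgroup_imp_normal[OF sub]
    by (intro exI[of _ N] exI[of _ "length xs"]) blast
qed

lemma order_Mod:
  assumes "N \<lhd> G" shows "Coset.order (G Mod N) = card (rcosets N)"
  by (simp add: Coset.order_def FactGroup_def)

end

context odd_group
begin

theorem supersolvable_if_anz_less_1:
  assumes "anz G < 1"
  shows "supersolvable G"
proof -
  \<comment> \<open>A quotient by 0 would be 0, so the trivial character is exhibited before the
    denominator is cleared.\<close>
  have "Irr G \<noteq> {}" using linear_trivial by (auto simp: linear_chars_def)
  hence "card (Irr G) > 0" using finite_Irr by (simp add: card_gt_0_iff)
  hence nz: "nz G < card (Irr G)" using assms by (simp add: anz_def)
  show ?thesis
  proof (cases "commutator_subgroup = {\<one>}")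
    case True
    have "x \<otimes> y = y \<otimes> x" if "x \<in> carrier G" "y \<in> carrier G" for x y
    proof -
      have "x \<otimes> y \<otimes> inv x \<otimes> inv y \<in> commutator_subgroup"
        unfolding commutator_subgroup_def derived_def by (rule generate.incl) (use that in auto)
      hence "x \<otimes> y \<otimes> inv x \<otimes> inv y = \<one>" using True by simp
      hence "x \<otimes> y = inv (inv x \<otimes> inv y)" using that by (metis inv_equality inv_closed inv_inv m_assoc m_closed)
      thus ?thesis using that by (simp add: inv_mult_group)
    qed
    hence "comm_group G" by (intro group_comm_groupI) auto
    thus ?thesis using fin by (rule supersolvable_if_comm)
  next
    case False
    define N where "N = (\<lambda>i::nat. if i = 0 then {\<one>} else if i = 1 then commutator_subgroup else carrier G)"
    have c1: "cyclic_group ((G\<lparr>carrier := commutator_subgroup\<rparr>) Mod {\<one>})"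
    proof -
      have n: "{\<one>} \<lhd> G\<lparr>carrier := commutator_subgroup\<rparr>"
        using normal_restrict_supergroup[OF commutator_subgroup_is_subgroup one_is_normal] subgroup.one_closed[OF commutator_subgroup_is_subgroup] by simp
      interpret H: group "G\<lparr>carrier := commutator_subgroup\<rparr>" by (rule subgroup_imp_group[OF commutator_subgroup_is_subgroup])
      have "card (rcosets\<^bsub>G\<lparr>carrier := commutator_subgroup\<rparr>\<^esub> {\<one>}) * card {\<one>} = card commutator_subgroup"
        using H.lagrange[OF normal_imp_subgroup[OF n]] by (simp add: Coset.order_def)
      hence "Coset.order (G\<lparr>carrier := commutator_subgroup\<rparr> Mod {\<one>}) = card commutator_subgroup" using H.order_Mod[OF n] by simp
      hence "prime (Coset.order (G\<lparr>carrier := commutator_subgroup\<rparr> Mod {\<one>}))"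
        using derived_structure(2)[OF nz False] by auto
      thus ?thesis by (rule group.cyclic_if_prime_order[OF normal.factorgroup_is_group[OF n]])
    qed
    have c2: "cyclic_group (G\<lparr>carrier := carrier G\<rparr> Mod commutator_subgroup)"
    proof -
      have "prime (Coset.order (G Mod commutator_subgroup))"
        using order_Mod[OF commutator_subgroup_normal] derived_structure(1)[OF nz False] by simp
      thus ?thesis using group.cyclic_if_prime_order[OF normal.factorgroup_is_group[OF commutator_subgroup_normal]] by simp
    qed
    have "N 0 = {\<one>}" "N 2 = carrier G" by (simp_all add: N_def)
    moreover have "\<forall>i\<le>2. N i \<lhd> G"
      using one_is_normal commutator_subgroup_normal by (simp add: N_def normal_inv_iff subgroup_self)
    moreover have "\<forall>i<2. N i \<subseteq> N (Suc i) \<and> cyclic_group (G\<lparr>carrier := N (Suc i)\<rparr> Mod N i)"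
      using c1 c2 subgroup.one_closed[OF commutator_subgroup_is_subgroup] subgroup.subset[OF commutator_subgroup_is_subgroup]
      by (auto simp: N_def less_2_cases_iff)
    ultimately show ?thesis unfolding supersolvable_def by blast
  qed
qed

end

theorem theoremF:
  fixes G :: "('a, 'b) monoid_scheme"
  assumes "group G"
    and "finite (carrier G)"
    and "odd (Coset.order G)"
    and "anz G < 1"
  shows "supersolvable G"
proof -
  interpret odd_group G
    using assms(1-3) by (intro odd_group.intro fin_group.intro fin_group_axioms.intro odd_group_axioms.intro)
  show ?thesis using assms(4) by (rule supersolvable_if_anz_less_1)
qed

end
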